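(* Let $K\neq\mathbb{Q}(\sqrt{-3})$ be an imaginary quadratic field. Then each circle of the Schmidt arrangement $\mathcal{S}_K$ belongs to exactly two $K$-Apollonian packings: one which is disjoint from the interior of the circle and one which is disjoint from its exterior (i.e. one lying in each of the two closed complementary regions of the circle). In particular, $\mathcal{S}_K$ is equal to the union of all $K$-Apollonian packings.
   Context: $\widehat{\mathbb{C}}=\mathbb{C}\cup\{\infty\}$; "circles" include straight lines (circles through $\infty$). Let $\mathcal{O}_K$ be the ring of integers of $K$. $\mathrm{PSL}_2(\mathcal{O}_K)$ acts on $\widehat{\mathbb{C}}$ by Möbius transformations. A $K$-Bianchi circle is a circle $M(\widehat{\mathbb{R}})$ with $M\in\mathrm{PSL}_2(\mathcal{O}_K)$, $\widehat{\mathbb{R}}=\mathbb{R}\cup\{\infty\}$; the Schmidt arrangement $\mathcal{S}_K$ is the set of all $K$-Bianchi circles. A collection $\mathcal{P}$ of circles straddles a circle $C$ if the union of the circles of $\mathcal{P}$ meets both complementary regions (interior and exterior) of $C$ nontrivially. $\mathcal{P}$ is tangency-connected if the graph whose vertices are the circles of $\mathcal{P}$ and whose edges join tangent circles is connected. A $K$-Apollonian packing is a maximal tangency-connected subset $\mathcal{P}\subseteq\mathcal{S}_K$ subject to the condition that $\mathcal{P}$ straddles no circle of $\mathcal{S}_K$. *)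

theory Defs
  imports "HOL-Analysis.Analysis" "HOL-Computational_Algebra.Computational_Algebra"
begin

section \<open>Imaginary quadratic fields as subfields of the complex numbers\<close>

definition quadratic_field :: "int \<Rightarrow> complex set" where
  "quadratic_field D = {of_rat a + of_rat b * csqrt (of_int D) | a b. True}"

text \<open>A negative integer is never a square, so squarefreeness of \<open>D\<close> need not be required.\<close>

definition imaginary_quadratic_field :: "complex set \<Rightarrow> bool" where
  "imaginary_quadratic_field K \<longleftrightarrow> (\<exists>D<0. K = quadratic_field D)"

definition ring_of_integers :: "complex set \<Rightarrow> complex set" where
  "ring_of_integers K = {x \<in> K. algebraic_int x}"


section \<open>The Schmidt arrangement\<close>

text \<open>The Riemann sphere is the one-point compactification of the plane. Its points are of type
  \<^typ>\<open>complex option\<close>, with \<^const>\<open>None\<close> as the point at infinity.\<close>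

definition riemann_sphere :: "complex option topology" where
  "riemann_sphere = Alexandroff_compactification euclidean"

definition extended_reals :: "complex option set" where
  "extended_reals = insert None (Some ` \<real>)"

fun moebius :: "complex^2^2 \<Rightarrow> complex option \<Rightarrow> complex option" where
  "moebius M None = (if M$2$1 = 0 then None else Some (M$1$1 / M$2$1))"
| "moebius M (Some z) =
    (if M$2$1 * z + M$2$2 = 0 then None
     else Some ((M$1$1 * z + M$1$2) / (M$2$1 * z + M$2$2)))"

definition SL2 :: "complex set \<Rightarrow> (complex^2^2) set" where
  "SL2 R = {M. (\<forall>i j. M$i$j \<in> R) \<and> det M = 1}"

text \<open>The matrices \<open>M\<close> and \<open>-M\<close> act in the same way, so the circles obtained from
  \<open>PSL\<^sub>2\<close> are those obtained from its representatives in \<open>SL\<^sub>2\<close>.\<close>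

definition schmidt_arrangement :: "complex set \<Rightarrow> complex option set set" where
  "schmidt_arrangement K = {moebius M ` extended_reals | M. M \<in> SL2 (ring_of_integers K)}"


section \<open>Apollonian packings\<close>

text \<open>For a circle \<open>C\<close> these are its two sides, the interior and the exterior. A line has no
  preferred side, so the two are not given different roles.\<close>

definition complementary_regions :: "complex option set \<Rightarrow> complex option set set" where
  "complementary_regions C = connected_components_of (subtopology riemann_sphere (- C))"

definition straddles :: "complex option set set \<Rightarrow> complex option set \<Rightarrow> bool" where
  "straddles P C \<longleftrightarrow> (\<forall>U \<in> complementary_regions C. \<Union>P \<inter> U \<noteq> {})"

text \<open>Circles that cross meet in two points of the sphere; parallel lines are tangent at infinity.\<close>

definition tangent :: "complex option set \<Rightarrow> complex option set \<Rightarrow> bool" where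
  "tangent C D \<longleftrightarrow> card (C \<inter> D) = 1"

definition tangency_connected :: "complex option set set \<Rightarrow> bool" where
  "tangency_connected P \<longleftrightarrow>
    (\<forall>C \<in> P. \<forall>D \<in> P. (C, D) \<in> {(A, B). A \<in> P \<and> B \<in> P \<and> tangent A B}\<^sup>*)"

definition packing_candidate :: "complex set \<Rightarrow> complex option set set \<Rightarrow> bool" where
  "packing_candidate K P \<longleftrightarrow>
    P \<subseteq> schmidt_arrangement K \<and> tangency_connected P \<and>
    (\<forall>C \<in> schmidt_arrangement K. \<not> straddles P C)"

definition apollonian_packing :: "complex set \<Rightarrow> complex option set set \<Rightarrow> bool" where
  "apollonian_packing K P \<longleftrightarrow>
    packing_candidate K P \<and> (\<forall>Q. packing_candidate K Q \<and> P \<subseteq> Q \<longrightarrow> Q = P)"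

end

theory Submission
  imports Defs
begin

no_notation fps_nth (infixl "$" 75)

text \<open>Write the ring of integers as \<open>R\<close>, and let \<open>w \<in> R\<close> have the least positive imaginary part;
  it is at least \<open>1\<close> because \<open>K \<noteq> \<rat>(\<surd>-3)\<close>. For \<open>M = (a b; c d)\<close> in \<open>SL\<^sub>2(R)\<close> the sign of \<open>Im (M x)\<close>
  at real \<open>x\<close> is that of a real quadratic form of discriminant \<open>1 - t\<^sup>2\<close> with
  \<open>t = Re (a cnj d - b cnj c) = 1 + 2 k (Im w)\<^sup>2\<close>, \<open>k\<close> an integer. Hence \<open>\<bar>t\<bar> \<ge> 1\<close>, the form is semidefinite,
  and two circles of the arrangement never cross.

  Let \<open>I\<close> be a side of a circle \<open>C\<close>. The candidates that contain \<open>C\<close> and avoid \<open>I\<close> have a union that is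
  again a candidate, since a circle straddled by the union would contain \<open>C\<close> and so be equal to it.
  This union is the packing on the other side of \<open>C\<close>. It is maximal as soon as it contains a circle besides \<open>C\<close>;
  when \<open>C\<close> is the real line, one of the horizontal lines through \<open>\<plusminus>w\<close> is such a circle: a circle separating
  the two lines passes through infinity, hence is a horizontal line at a height in \<open>(Im w) \<int>\<close>, and
  there is none in between.\<close>

section \<open>Integers of imaginary quadratic fields\<close>

text \<open>With \<open>q = a / b\<close> in lowest terms, integrality of \<open>N * q ^ k\<close>
  makes \<open>b ^ k\<close> divide the fixed nonzero \<open>N\<close> for every \<open>k\<close>,
  which forces \<open>b = 1\<close>. Bounded denominators of powers thus detect integrality.\<close>

lemma Ints_if_multiple_powers_Ints:
  fixes q :: complex
  assumes "q \<in> \<rat>" "N \<noteq> 0" and pow: "\<And>k. of_int N * q ^ k \<in> \<int>"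
  shows "q \<in> \<int>"
proof -
  obtain a b where ab: "b > 0" "coprime a b" "q = of_int a / of_int b"
    using assms(1) by (auto elim: Rats_cases')
  have dvd: "b ^ k dvd N" for k
  proof -
    obtain m where "of_int N * q ^ k = of_int m"
      using pow[of k] by (auto elim: Ints_cases)
    then have "of_int (N * a ^ k) = (of_int (m * b ^ k) :: complex)"
      using ab by (simp add: field_simps)
    then have "N * a ^ k = m * b ^ k"
      by (simp only: of_int_eq_iff)
    then have "b ^ k dvd N * a ^ k" by simp
    moreover have "coprime (b ^ k) (a ^ k)"
      using ab(2) by (simp add: coprime_commute)
    ultimately show ?thesis
      by (simp add: coprime_dvd_mult_left_iff)
  qed
  have "b = 1"
  proof (rule ccontr)
    assume "b \<noteq> 1"
    then have b2: "b \<ge> 2" using ab by simp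
    \<comment> \<open>The exponent \<open>nat |N|\<close> works because \<open>2 ^ m > m\<close>:
      the power of \<open>b\<close> is then too large to divide \<open>N\<close>.\<close>
    have "(2::int) ^ nat \<bar>N\<bar> \<le> b ^ nat \<bar>N\<bar>"
      using b2 by (intro power_mono) auto
    also have "\<dots> \<le> \<bar>N\<bar>"
      using dvd_imp_le_int[OF assms(2) dvd[of "nat \<bar>N\<bar>"]] ab by simp
    also have "\<dots> < 2 ^ nat \<bar>N\<bar>"
      using less_exp[of "nat \<bar>N\<bar>"] by (metis abs_ge_zero int_nat_eq of_nat_less_numeral_power_cancel_iff)
    finally show False by simp
  qed
  then show ?thesis using ab by simp
qed

lemma Ints_if_square_Ints:
  fixes q :: complex
  assumes "q \<in> \<rat>" "q * q \<in> \<int>"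
  shows "q \<in> \<int>"
proof (rule rational_algebraic_int_is_int)
  show "algebraic_int q"
  proof
    show "poly [:- (q * q), 0, 1:] q = 0" by simp
    show "\<forall>i. coeff [:- (q * q), 0, 1:] i \<in> \<int>"
      using assms(2) by (auto simp: coeff_pCons split: nat.splits)
  qed simp
qed fact

section \<open>Conjugation, trace and norm in an imaginary quadratic field\<close>

locale imaginary_quadratic =
  fixes D :: int
  assumes D_neg: "D < 0"
begin

abbreviation K :: "complex set" where "K \<equiv> quadratic_field D"

abbreviation r :: complex where "r \<equiv> csqrt (of_int D)"

lemma r_square: "r * r = of_int D"
  by (metis power2_csqrt power2_eq_square)

lemma r_eq: "r = \<i> * sqrt (- D)"
  using D_neg by (simp add: csqrt.code complex_eq_iff real_sqrt_minus)

lemma Im_r: "Im r = sqrt (- D)"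
  unfolding r_eq by simp

lemma cnj_r [simp]: "cnj r = - r"
  unfolding r_eq by simp

lemma cnj_of_rat [simp]: "cnj (of_rat a) = of_rat a"
  by (cases a rule: Rat_cases) (simp add: of_rat_rat)

lemma field_mem [intro]: "of_rat a + of_rat b * r \<in> K"
  by (auto simp: quadratic_field_def)

lemma fieldE:
  assumes "x \<in> K"
  obtains a b where "x = of_rat a + of_rat b * r"
  using assms by (auto simp: quadratic_field_def)

lemma field_add: "x + y \<in> K" if prems: "x \<in> K" "y \<in> K"
proof -
  obtain a b c d where "x = of_rat a + of_rat b * r" "y = of_rat c + of_rat d * r"
    using prems by (meson fieldE)
  then have "x + y = of_rat (a + c) + of_rat (b + d) * r"
    by (simp add: of_rat_add algebra_simps)
  then show ?thesis by auto
qed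

lemma field_mult: "x * y \<in> K" if prems: "x \<in> K" "y \<in> K"
proof -
  obtain a b c d where "x = of_rat a + of_rat b * r" "y = of_rat c + of_rat d * r"
    using prems by (meson fieldE)
  then have "x * y = of_rat a * of_rat c + of_rat b * of_rat d * (r * r)
      + (of_rat a * of_rat d + of_rat b * of_rat c) * r"
    by (simp add: algebra_simps)
  also have "\<dots> = of_rat (a * c + b * d * of_int D) + of_rat (a * d + b * c) * r"
    unfolding r_square by (simp add: of_rat_add of_rat_mult)
  finally show ?thesis by auto
qed

lemma field_cnj: "cnj x \<in> K" if prems: "x \<in> K"
proof -
  obtain a b where "x = of_rat a + of_rat b * r"
    using prems by (rule fieldE)
  then have "cnj x = of_rat a + of_rat (- b) * r"
    by (simp add: of_rat_minus)
  then show ?thesis by auto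
qed

lemma trace_rat: "x + cnj x \<in> \<rat>" if prems: "x \<in> K"
proof -
  obtain a b where "x = of_rat a + of_rat b * r"
    using prems by (rule fieldE)
  then have "x + cnj x = of_rat (2 * a)"
    by (simp add: of_rat_mult)
  then show ?thesis by simp
qed

lemma diff_cnj_mult_rat: "(x - cnj x) * (y - cnj y) \<in> \<rat>" if prems: "x \<in> K" "y \<in> K"
proof -
  obtain a b c d where "x = of_rat a + of_rat b * r" "y = of_rat c + of_rat d * r"
    using prems by (meson fieldE)
  then have "(x - cnj x) * (y - cnj y) = of_rat (4 * b * d) * (r * r)"
    by (simp add: of_rat_mult algebra_simps)
  also have "\<dots> = of_rat (4 * b * d * of_int D)"
    unfolding r_square by (simp add: of_rat_mult)
  finally show ?thesis by simp
qed

lemma norm_rat: "x * cnj x \<in> \<rat>" if prems: "x \<in> K"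
proof -
  have "x * cnj x = ((x + cnj x) * (x + cnj x) - (x - cnj x) * (x - cnj x)) / 4"
    by (simp add: algebra_simps)
  also have "\<dots> \<in> \<rat>"
    using prems by (intro Rats_divide Rats_diff Rats_mult trace_rat diff_cnj_mult_rat) auto
  finally show ?thesis .
qed

text \<open>The order generated by the square root \<open>r\<close>. It can be smaller than the ring
  of integers and serves only to bound denominators.\<close>

definition lattice :: "complex set" where
  "lattice = {of_int m + of_int n * r | m n. True}"

lemma lattice_mem [intro]: "of_int m + of_int n * r \<in> lattice"
  by (auto simp: lattice_def)

lemma lattice_add: "x + y \<in> lattice" if prems: "x \<in> lattice" "y \<in> lattice"
proof -
  obtain m n p q where "x = of_int m + of_int n * r" "y = of_int p + of_int q * r"
    using prems by (auto simp: lattice_def)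
  then have "x + y = of_int (m + p) + of_int (n + q) * r"
    by (simp add: algebra_simps)
  then show ?thesis by (simp only: lattice_mem)
qed

lemma lattice_mult: "x * y \<in> lattice" if prems: "x \<in> lattice" "y \<in> lattice"
proof -
  obtain m n p q where "x = of_int m + of_int n * r" "y = of_int p + of_int q * r"
    using prems by (auto simp: lattice_def)
  then have "x * y = of_int m * of_int p + of_int n * of_int q * (r * r)
      + (of_int m * of_int q + of_int n * of_int p) * r"
    by (simp add: algebra_simps)
  also have "\<dots> = of_int (m * p + n * q * D) + of_int (m * q + n * p) * r"
    unfolding r_square by simp
  finally show ?thesis by (simp only: lattice_mem)
qed

lemma lattice_Ints: "x \<in> lattice" if prems: "x \<in> \<int>"
proof -
  obtain m where "x = of_int m + of_int 0 * r"
    using prems by (auto elim: Ints_cases)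
  then show ?thesis by blast
qed

lemma lattice_cnj: "cnj x \<in> lattice" if prems: "x \<in> lattice"
proof -
  obtain m n where "x = of_int m + of_int n * r"
    using prems by (auto simp: lattice_def)
  then have "cnj x = of_int m + of_int (- n) * r"
    by simp
  then show ?thesis by (simp only: lattice_mem)
qed

lemma lattice_power: "x ^ k \<in> lattice" if prems: "x \<in> lattice"
  by (induction k) (auto intro: prems lattice_mult lattice_Ints)

lemma lattice_sum: "(\<And>i. i \<in> A \<Longrightarrow> f i \<in> lattice) \<Longrightarrow> sum f A \<in> lattice"
  by (induction A rule: infinite_finite_induct) (auto intro: lattice_add lattice_Ints)

lemma lattice_real: "x \<in> \<int>" if prems: "x \<in> lattice" "x \<in> \<real>"
proof -
  obtain m n where mn: "x = of_int m + of_int n * r"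
    using prems by (auto simp: lattice_def)
  have "of_int n * sqrt (- D) = 0"
    using prems(2) unfolding mn r_eq complex_is_Real_iff by simp
  then have "n = 0" using D_neg by simp
  then show ?thesis by (simp add: mn)
qed

lemma common_denominator:
  assumes "x \<in> K"
  obtains d where "d \<noteq> 0" "of_int d * x \<in> lattice"
proof -
  obtain a b where x: "x = of_rat a + of_rat b * r"
    using assms by (rule fieldE)
  obtain m n p q where mnpq: "a = of_int m / of_int n" "n \<noteq> 0" "b = of_int p / of_int q" "q \<noteq> 0"
    by (metis Fract_of_int_quotient Rat_cases less_irrefl)
  have "of_int (n * q) * x = of_int (m * q) + of_int (p * n) * r"
    using mnpq(2,4) by (simp add: x mnpq(1,3) of_rat_divide field_simps)
  then show ?thesis
    using that[of "n * q"] mnpq by (metis lattice_mem mult_eq_0_iff)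
qed

text \<open>If \<open>d\<close> clears the denominator of \<open>x\<close>, then
  \<open>d ^ n\<close> clears those of all powers up to the degree \<open>n\<close> of a monic
  equation for \<open>x\<close>. That equation rewrites every higher power through lower ones with
  integer coefficients, so the same multiplier keeps working.\<close>

lemma algebraic_int_powers_denominator:
  assumes "x \<in> K" "algebraic_int x"
  obtains N where "N \<noteq> 0" "\<And>k. of_int N * x ^ k \<in> lattice"
proof -
  obtain d where d: "d \<noteq> 0" "of_int d * x \<in> lattice"
    using assms(1) by (rule common_denominator)
  obtain p where p: "lead_coeff p = 1" "\<forall>i. coeff p i \<in> \<int>" "poly p x = 0"
    using assms(2) by (auto simp: algebraic_int.simps)
  define n where "n = degree p"
  define N where "N = d ^ n"
  have *: "of_int N * x ^ k \<in> lattice" for k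
  proof (induction k rule: less_induct)
    case (less k)
    show ?case
    proof (cases "k \<le> n")
      case True
      have "of_int N * x ^ k = of_int (d ^ (n - k)) * (of_int d * x) ^ k"
        using True by (simp add: N_def power_mult_distrib flip: power_add mult.assoc)
      then show ?thesis
        using d by (metis Ints_of_int lattice_Ints lattice_mult lattice_power)
    next
      case False
      have "0 = (\<Sum>i\<le>n. coeff p i * x ^ i)"
        using p(3) by (simp add: poly_altdef n_def)
      also have "\<dots> = (\<Sum>i<n. coeff p i * x ^ i) + x ^ n"
        using p(1) by (simp add: n_def flip: lessThan_Suc_atMost)
      finally have xn: "x ^ n = - (\<Sum>i<n. coeff p i * x ^ i)"
        by (simp add: eq_neg_iff_add_eq_0 add.commute)
      have "of_int N * x ^ k = of_int N * x ^ (k - n) * x ^ n"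
        using False by (simp add: mult.assoc flip: power_add)
      also have "\<dots> = (\<Sum>i<n. (- coeff p i) * (of_int N * x ^ (k - n + i)))"
        unfolding xn by (simp add: sum_distrib_left sum_negf power_add mult_ac)
      also have "\<dots> \<in> lattice"
        using False p(2) by (intro lattice_sum lattice_mult lattice_Ints less) auto
      finally show ?thesis .
    qed
  qed
  have "N \<noteq> 0" using d by (simp add: N_def)
  then show ?thesis using that * by blast
qed

text \<open>The multiplier \<open>N\<close> for the powers of \<open>x\<close> also serves those of
  \<open>cnj x\<close>, so \<open>N * N\<close> clears the powers of trace and norm. These are real,
  and real lattice points are integers, so \<open>Ints_if_multiple_powers_Ints\<close>
  applies.\<close>

lemma algebraic_int_trace_norm:
  assumes "x \<in> K" "algebraic_int x"
  shows "x + cnj x \<in> \<int>" "x * cnj x \<in> \<int>"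
proof -
  obtain N where N: "N \<noteq> 0" "\<And>k. of_int N * x ^ k \<in> lattice"
    using assms by (rule algebraic_int_powers_denominator) blast
  have N': "of_int N * cnj x ^ k \<in> lattice" for k
    using lattice_cnj[OF N(2)[of k]] by simp
  have prod: "of_int (N * N) * (x ^ i * cnj x ^ j) \<in> lattice" for i j
    using lattice_mult[OF N(2)[of i] N'[of j]] by (simp add: mult_ac)
  show "x + cnj x \<in> \<int>"
  proof (rule Ints_if_multiple_powers_Ints[where N = "N * N"])
    fix k
    have "of_int (N * N) * (x + cnj x) ^ k
        = (\<Sum>i\<le>k. of_nat (k choose i) * (of_int (N * N) * (x ^ i * cnj x ^ (k - i))))"
      by (simp add: binomial_ring sum_distrib_left mult_ac)
    also have "\<dots> \<in> lattice"
      by (intro lattice_sum lattice_mult[OF lattice_Ints prod]) auto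
    finally show "of_int (N * N) * (x + cnj x) ^ k \<in> \<int>"
      by (rule lattice_real) (simp add: complex_add_cnj)
  qed (use N trace_rat assms in auto)
  show "x * cnj x \<in> \<int>"
  proof (rule Ints_if_multiple_powers_Ints[where N = "N * N"])
    fix k
    have "of_int (N * N) * (x * cnj x) ^ k \<in> lattice"
      using prod[of k k] by (simp add: power_mult_distrib)
    then show "of_int (N * N) * (x * cnj x) ^ k \<in> \<int>"
      by (rule lattice_real) (simp add: complex_mult_cnj flip: of_real_power of_real_add)
  qed (use N norm_rat assms in auto)
qed

text \<open>For the converse, \<open>x\<close> is a root of the monic quadratic with roots
  \<open>x\<close> and \<open>cnj x\<close>. Integrality becomes a condition on two numbers, so that
  ring closure can be checked by computation.\<close>

lemma mem_ring_of_integers_iff: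
  "x \<in> ring_of_integers K \<longleftrightarrow> x \<in> K \<and> x + cnj x \<in> \<int> \<and> x * cnj x \<in> \<int>"
proof
  assume "x \<in> K \<and> x + cnj x \<in> \<int> \<and> x * cnj x \<in> \<int>"
  moreover have "algebraic_int x" if "x + cnj x \<in> \<int>" "x * cnj x \<in> \<int>"
  proof
    show "poly [:x * cnj x, - (x + cnj x), 1:] x = 0"
      by (simp add: algebra_simps)
    show "\<forall>i. coeff [:x * cnj x, - (x + cnj x), 1:] i \<in> \<int>"
      using that Ints_minus[OF that(1)] by (auto simp: coeff_pCons split: nat.splits)
  qed simp
  ultimately show "x \<in> ring_of_integers K"
    by (simp add: ring_of_integers_def)
qed (auto simp: ring_of_integers_def algebraic_int_trace_norm)

abbreviation OK :: "complex set" where "OK \<equiv> ring_of_integers K"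

lemma integers_of_int: "of_int n \<in> OK"
proof -
  have "of_rat (of_int n) + of_rat 0 * r \<in> K" by blast
  then have "complex_of_int n \<in> K" by simp
  then show ?thesis by (simp add: ring_of_integers_def)
qed

lemma integers_cnj: "cnj x \<in> OK" if "x \<in> OK"
  using that by (simp add: mem_ring_of_integers_iff field_cnj add.commute mult.commute)

text \<open>These are the traces of \<open>x * cnj y\<close> and \<open>x * y\<close>. The product
  \<open>p\<close> of the two differences is rational and its square is the product of the
  discriminants \<open>s * s - 4 * n\<close>. So \<open>p\<close> is an integer of the same parity
  as \<open>s1 * s2\<close>, and the sums are the halves of \<open>s1 * s2 - p\<close> and
  \<open>s1 * s2 + p\<close>.\<close>

lemma integers_half_sums:
  assumes "x \<in> OK" "y \<in> OK"
  shows "x * cnj y + cnj x * y \<in> \<int>" "x * y + cnj x * cnj y \<in> \<int>"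
proof -
  have x: "x \<in> K" "x + cnj x \<in> \<int>" "x * cnj x \<in> \<int>"
    and y: "y \<in> K" "y + cnj y \<in> \<int>" "y * cnj y \<in> \<int>"
    using assms by (auto simp: mem_ring_of_integers_iff)
  obtain s1 s2 n1 n2 where s: "x + cnj x = of_int s1" "y + cnj y = of_int s2"
    and n: "x * cnj x = of_int n1" "y * cnj y = of_int n2"
    using x y by (meson Ints_cases)
  let ?p = "(x - cnj x) * (y - cnj y)"
  have "?p * ?p = ((x + cnj x) * (x + cnj x) - 4 * (x * cnj x))
      * ((y + cnj y) * (y + cnj y) - 4 * (y * cnj y))"
    by (simp add: algebra_simps)
  also have "\<dots> = of_int ((s1 * s1 - 4 * n1) * (s2 * s2 - 4 * n2))"
    unfolding s n by simp
  finally have pp: "?p * ?p = of_int ((s1 * s1 - 4 * n1) * (s2 * s2 - 4 * n2))" .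
  then have "?p * ?p \<in> \<int>" by (metis Ints_of_int)
  then have "?p \<in> \<int>"
    using Ints_if_square_Ints diff_cnj_mult_rat[OF x(1) y(1)] by blast
  then obtain p where p: "?p = of_int p" by (rule Ints_cases)
  have "p * p = (s1 * s1 - 4 * n1) * (s2 * s2 - 4 * n2)"
    using pp unfolding p of_int_mult[symmetric] of_int_eq_iff .
  also have "\<dots> = (s1 * s2) * (s1 * s2) + 2 * (8 * n1 * n2 - 2 * n1 * (s2 * s2) - 2 * n2 * (s1 * s1))"
    by (simp add: algebra_simps)
  finally have "even (p * p) \<longleftrightarrow> even ((s1 * s2) * (s1 * s2))"
    by simp
  then have par: "even p \<longleftrightarrow> even (s1 * s2)"
    by auto
  have "even (s1 * s2 - p)" "even (s1 * s2 + p)"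
    using par by (simp_all only: even_add even_diff)
  then obtain u v where uv: "s1 * s2 - p = 2 * u" "s1 * s2 + p = 2 * v"
    unfolding dvd_def by blast
  have "2 * (x * cnj y + cnj x * y) = (x + cnj x) * (y + cnj y) - ?p"
    by (simp add: algebra_simps)
  also have "\<dots> = of_int (2 * u)"
    unfolding s p uv(1)[symmetric] by simp
  finally have "x * cnj y + cnj x * y = of_int u"
    by (metis mult_cancel_left zero_neq_numeral of_int_mult of_int_numeral)
  then show "x * cnj y + cnj x * y \<in> \<int>" by (metis Ints_of_int)
  have "2 * (x * y + cnj x * cnj y) = (x + cnj x) * (y + cnj y) + ?p"
    by (simp add: algebra_simps)
  also have "\<dots> = of_int (2 * v)"
    unfolding s p uv(2)[symmetric] by simp
  finally have "x * y + cnj x * cnj y = of_int v"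
    by (metis mult_cancel_left zero_neq_numeral of_int_mult of_int_numeral)
  then show "x * y + cnj x * cnj y \<in> \<int>" by (metis Ints_of_int)
qed

lemma integers_add: "x + y \<in> OK" if xy: "x \<in> OK" "y \<in> OK"
proof -
  have "(x + y) + cnj (x + y) = (x + cnj x) + (y + cnj y)"
    "(x + y) * cnj (x + y) = x * cnj x + y * cnj y + (x * cnj y + cnj x * y)"
    by (simp_all add: algebra_simps)
  moreover have "(x + cnj x) + (y + cnj y) \<in> \<int>"
    "x * cnj x + y * cnj y + (x * cnj y + cnj x * y) \<in> \<int>"
    using xy integers_half_sums(1)[OF xy] unfolding mem_ring_of_integers_iff by (metis Ints_add)+
  moreover have "x + y \<in> K"
    using xy by (auto simp: mem_ring_of_integers_iff intro: field_add)
  ultimately show ?thesis by (simp only: mem_ring_of_integers_iff)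
qed

lemma integers_mult: "x * y \<in> OK" if xy: "x \<in> OK" "y \<in> OK"
proof -
  have "(x * y) * cnj (x * y) = (x * cnj x) * (y * cnj y)"
    by (simp add: algebra_simps)
  moreover have "(x * cnj x) * (y * cnj y) \<in> \<int>"
    using xy unfolding mem_ring_of_integers_iff by (metis Ints_mult)
  moreover have "x * y \<in> K"
    using xy by (auto simp: mem_ring_of_integers_iff intro: field_mult)
  ultimately show ?thesis using integers_half_sums(2)[OF xy]
    by (simp only: mem_ring_of_integers_iff complex_cnj_mult)
qed

text \<open>For real \<open>x\<close> the trace is \<open>2 * x\<close>, which gives rationality,
  and the norm is \<open>x * x\<close>, which gives integrality.\<close>

lemma integers_real:
  assumes "x \<in> OK" "x \<in> \<real>"
  shows "x \<in> \<int>"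
proof -
  have cnj: "cnj x = x" using assms(2) by (simp add: Reals_cnj_iff)
  have "x + x \<in> \<rat>"
    using assms(1) trace_rat[of x] unfolding mem_ring_of_integers_iff cnj by blast
  then have "(x + x) / 2 \<in> \<rat>"
    by (rule Rats_divide) simp
  then have "x \<in> \<rat>" by simp
  then show ?thesis
    using assms(1) Ints_if_square_Ints unfolding mem_ring_of_integers_iff cnj by blast
qed

section \<open>Imaginary parts of integers of the field\<close>

lemma r_integer: "r \<in> OK"
proof -
  have "of_rat 0 + of_rat 1 * r \<in> K" by blast
  then have "r \<in> K" by simp
  moreover have "r + cnj r \<in> \<int>" unfolding cnj_r by simp
  moreover have "r * cnj r \<in> \<int>" unfolding cnj_r mult_minus_right r_square by simp
  ultimately show ?thesis unfolding mem_ring_of_integers_iff by blast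
qed

text \<open>With trace \<open>s\<close> and norm \<open>n\<close> this is the negated discriminant
  of the quadratic polynomial of \<open>x\<close>.\<close>

lemma four_Im_square:
  assumes "x \<in> OK"
  obtains s n :: int where "4 * (Im x)\<^sup>2 = of_int (4 * n - s * s)"
proof -
  obtain s n where sn: "x + cnj x = of_int s" "x * cnj x = of_int n"
    using assms by (auto simp: mem_ring_of_integers_iff elim!: Ints_cases)
  have "2 * Re x = of_int s"
    using arg_cong[OF sn(1), of Re] by simp
  moreover have "(Re x)\<^sup>2 + (Im x)\<^sup>2 = of_int n"
    using arg_cong[OF sn(2), of Re] by (simp add: power2_eq_square)
  moreover have "4 * (Re x)\<^sup>2 = (2 * Re x) * (2 * Re x)"
    by (simp add: power2_eq_square)
  ultimately have "4 * (Im x)\<^sup>2 = of_int (4 * n - s * s)"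
    by simp
  then show ?thesis by (rule that)
qed

text \<open>An imaginary part below 1 makes \<open>4 * n - s * s\<close> an integer strictly between
  0 and 4. It is congruent to 0 or 3 modulo 4, hence equal to 3, and then the field contains a
  square root of -3.\<close>

lemma Im_ge_1:
  assumes "K \<noteq> quadratic_field (-3)" "x \<in> OK" "Im x > 0"
  shows "Im x \<ge> 1"
proof (rule ccontr)
  assume "\<not> Im x \<ge> 1"
  then have lt: "4 * (Im x)\<^sup>2 < 4"
    using assms(3) abs_square_less_1[of "Im x"] by linarith
  have gt: "4 * (Im x)\<^sup>2 > 0" using assms(3) by simp
  obtain s n :: int where sn: "4 * (Im x)\<^sup>2 = of_int (4 * n - s * s)"
    using assms(2) by (rule four_Im_square)
  have b: "4 * n - s * s < 4" "4 * n - s * s > 0"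
    using lt gt unfolding sn by linarith+
  have "\<exists>m. s * s = 4 * m \<or> s * s = 4 * m + 1"
  proof (cases "even s")
    case True
    then obtain k where "s = 2 * k" by (rule evenE)
    then have "s * s = 4 * (k * k)" by simp
    then show ?thesis by blast
  next
    case False
    then obtain k where "s = 2 * k + 1" by (rule oddE)
    then have "s * s = 4 * (k * k + k) + 1" by (simp add: algebra_simps)
    then show ?thesis by blast
  qed
  then obtain m where "s * s = 4 * m \<or> s * s = 4 * m + 1" ..
  moreover have "4 * n - q = 3" if "4 * n - q < 4" "4 * n - q > 0" "q = 4 * m \<or> q = 4 * m + 1" for q
    using that by presburger
  ultimately have "4 * n - s * s = 3" using b by blast
  with sn have Im3: "4 * (Im x)\<^sup>2 = 3" by simp
  obtain a b where x: "x = of_rat a + of_rat b * r"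
    using assms(2) fieldE[of x] by (auto simp: mem_ring_of_integers_iff)
  let ?z = "csqrt (of_int (-3))"
  interpret z: imaginary_quadratic "-3" by unfold_locales simp
  have rat_Re: "complex_of_rat q = of_real (of_rat q)" for q
    by (cases q rule: Rat_cases) (simp add: of_rat_rat)
  have "Im x = of_rat b * sqrt (- D)"
    unfolding x r_eq by (simp add: rat_Re)
  then have b0: "of_rat b > (0::real)"
    using assms(3) D_neg by (metis zero_less_mult_pos2 real_sqrt_gt_zero neg_0_less_iff_less of_int_0_less_iff)
  \<comment> \<open>Since \<open>Im x\<close> is the rational \<open>b\<close> times
    \<open>Im r\<close>, this exhibits the square root of -3 as the rational multiple
    \<open>2 * b\<close> of \<open>r\<close>, so both fields have the same elements.\<close>
  have "sqrt 3 = 2 * Im x"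
    by (rule real_sqrt_unique) (use Im3 assms(3) in \<open>simp_all add: power_mult_distrib\<close>)
  then have z1: "?z = of_rat (2 * b) * r"
    unfolding z.r_eq r_eq \<open>Im x = _\<close> by (simp add: rat_Re of_rat_mult)
  have z2: "r = of_rat (1 / (2 * b)) * ?z"
    unfolding z1 using b0 by (auto simp: of_rat_mult of_rat_divide)
  have "K = quadratic_field (-3)"
  proof
    show "K \<subseteq> quadratic_field (-3)"
    proof
      fix y assume "y \<in> K"
      then obtain c d where "y = of_rat c + of_rat d * r" by (rule fieldE)
      then have "y = of_rat c + of_rat (d * (1 / (2 * b))) * ?z"
        by (subst (asm) z2) (simp only: of_rat_mult mult.assoc)
      then show "y \<in> quadratic_field (-3)" unfolding quadratic_field_def by blast
    qed
    show "quadratic_field (-3) \<subseteq> K"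
    proof
      fix y assume "y \<in> quadratic_field (-3)"
      then obtain c d where "y = of_rat c + of_rat d * ?z" by (rule z.fieldE)
      then have "y = of_rat c + of_rat (d * (2 * b)) * r"
        unfolding z1 by (simp add: of_rat_mult)
      then show "y \<in> K" unfolding quadratic_field_def by blast
    qed
  qed
  with assms(1) show False by simp
qed

text \<open>A least element exists because \<open>4 * (Im x)\<^sup>2\<close> takes natural values on
  the integers of the field. The set in question contains \<open>r\<close>.\<close>

lemma minimal_Im:
  obtains w where "w \<in> OK" "Im w > 0" "\<And>x. x \<in> OK \<Longrightarrow> Im x > 0 \<Longrightarrow> Im w \<le> Im x"
proof -
  \<comment> \<open>The floor loses nothing on \<open>OK\<close>; it only moves the values to
    \<open>nat\<close> for the minimum principle.\<close>
  define f where "f x = nat \<lfloor>4 * (Im x)\<^sup>2\<rfloor>" for x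
  have f: "of_nat (f x) = 4 * (Im x)\<^sup>2" if x: "x \<in> OK" for x
  proof -
    obtain s n :: int where "4 * (Im x)\<^sup>2 = of_int (4 * n - s * s)"
      using x by (rule four_Im_square)
    moreover have "4 * (Im x)\<^sup>2 \<ge> 0" by simp
    ultimately show ?thesis unfolding f_def by simp
  qed
  have "r \<in> OK \<and> Im r > 0"
    using r_integer D_neg by (simp add: Im_r)
  then obtain w where w: "w \<in> OK \<and> Im w > 0" "\<And>x. x \<in> OK \<and> Im x > 0 \<Longrightarrow> f w \<le> f x"
    using ex_has_least_nat[of "\<lambda>x. x \<in> OK \<and> Im x > 0" r f] by (metis (lifting))
  show ?thesis
  proof
    fix x assume x: "x \<in> OK" "Im x > 0"
    then have "real (f w) \<le> real (f x)" using w(2)[of x] by simp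
    then have "(Im w)\<^sup>2 \<le> (Im x)\<^sup>2" using f w(1) x(1) by simp
    then show "Im w \<le> Im x" using x(2) power2_le_imp_le by fastforce
  qed (use w in auto)
qed

end

text \<open>The properties of the ring of integers on which the geometry rests. The exclusion of the
  field of \<open>csqrt (-3)\<close> enters through \<open>Im_w\<close>.\<close>

locale quadratic_order =
  fixes R :: "complex set" and w :: complex
  assumes of_int_mem: "\<And>n. of_int n \<in> R"
    and add_mem: "\<And>x y. x \<in> R \<Longrightarrow> y \<in> R \<Longrightarrow> x + y \<in> R"
    and mult_mem: "\<And>x y. x \<in> R \<Longrightarrow> y \<in> R \<Longrightarrow> x * y \<in> R"
    and cnj_mem: "\<And>x. x \<in> R \<Longrightarrow> cnj x \<in> R"
    and w_mem: "w \<in> R"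
    and Im_w: "Im w \<ge> 1"
    and Im_mem: "\<And>x. x \<in> R \<Longrightarrow> \<exists>k::int. Im x = of_int k * Im w"
    and real_mem: "\<And>x. x \<in> R \<Longrightarrow> x \<in> \<real> \<Longrightarrow> x \<in> \<int>"

text \<open>Division with remainder on imaginary parts: after subtracting a multiple of
  \<open>w\<close> the remainder lies in \<open>[0, Im w)\<close>, so by minimality it is 0.\<close>

lemma (in imaginary_quadratic) quadratic_order_integers:
  assumes "K \<noteq> quadratic_field (-3)"
  shows "\<exists>w. quadratic_order OK w"
proof -
  obtain w where w: "w \<in> OK" "Im w > 0" "\<And>x. x \<in> OK \<Longrightarrow> Im x > 0 \<Longrightarrow> Im w \<le> Im x"
    by (rule minimal_Im) blast
  have "\<exists>k::int. Im x = of_int k * Im w" if "x \<in> OK" for x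
  proof -
    define k where "k = \<lfloor>Im x / Im w\<rfloor>"
    have x1: "x + of_int (- k) * w \<in> OK"
      using that w(1) by (intro integers_add integers_mult integers_of_int)
    have Im: "Im (x + of_int (- k) * w) = Im x - of_int k * Im w" by simp
    have k: "of_int k * Im w \<le> Im x" "Im x < (of_int k + 1) * Im w"
      using floor_correct[of "Im x / Im w"] w(2) unfolding k_def
      by (simp_all only: pos_le_divide_eq pos_divide_less_eq of_int_add of_int_1)
    have "\<not> Im (x + of_int (- k) * w) > 0"
    proof
      assume "Im (x + of_int (- k) * w) > 0"
      then have "Im w \<le> Im x - of_int k * Im w" using w(3)[OF x1] Im by simp
      then show False using k(2) by (simp only: distrib_right mult_1)
    qed
    then have "Im x = of_int k * Im w" using Im k(1) by linarith
    then show ?thesis ..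
  qed
  then have "quadratic_order OK w"
    by (intro quadratic_order.intro integers_of_int integers_add integers_mult integers_cnj
        integers_real w Im_ge_1[OF assms]) blast
  then show ?thesis ..
qed


section \<open>Moebius transformations of the Riemann sphere\<close>

text \<open>Homogeneous coordinates on the projective line. In them a Moebius map is linear, so
  infinity needs no separate case.\<close>

definition point :: "complex \<Rightarrow> complex \<Rightarrow> complex option" where
  "point u v = (if v = 0 then None else Some (u / v))"

lemma Some_eq_point: "Some z = point z 1"
  and None_eq_point: "None = point 1 0"
  by (simp_all add: point_def)

lemma point_cases:
  obtains u v where "p = point u v" "u \<noteq> 0 \<or> v \<noteq> 0"
  using that[of 1 0] that[of _ 1] by (cases p) (simp_all add: None_eq_point Some_eq_point)

lemma moebius_point:
  assumes "u \<noteq> 0 \<or> v \<noteq> 0"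
  shows "moebius M (point u v) = point (M$1$1 * u + M$1$2 * v) (M$2$1 * u + M$2$2 * v)"
proof (cases "v = 0")
  case True
  then show ?thesis using assms by (simp add: point_def)
next
  case False
  have eq: "x * u + y * v = (x * (u / v) + y) * v" for x y
    using False by (simp add: field_simps)
  show ?thesis
    unfolding eq using False by (simp add: point_def)
qed

text \<open>Cramer's rule: \<open>det M * u\<close> and \<open>det M * v\<close> are combinations of
  the two image coordinates.\<close>

lemma det_nonzero_imp_image_nonzero:
  fixes M :: "complex^2^2"
  assumes "det M \<noteq> 0" "u \<noteq> 0 \<or> v \<noteq> 0"
  shows "M$1$1 * u + M$1$2 * v \<noteq> 0 \<or> M$2$1 * u + M$2$2 * v \<noteq> 0"
proof (rule ccontr)
  assume "\<not> ?thesis"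
  then have *: "M$1$1 * u + M$1$2 * v = 0" "M$2$1 * u + M$2$2 * v = 0" by auto
  have "det M * u = M$2$2 * (M$1$1 * u + M$1$2 * v) - M$1$2 * (M$2$1 * u + M$2$2 * v)"
    "det M * v = M$1$1 * (M$2$1 * u + M$2$2 * v) - M$2$1 * (M$1$1 * u + M$1$2 * v)"
    by (simp_all add: det_2 algebra_simps)
  then show False using assms unfolding * by simp
qed

lemma moebius_mult:
  assumes "det N \<noteq> 0"
  shows "moebius (M ** N) p = moebius M (moebius N p)"
proof -
  obtain u v where uv: "p = point u v" "u \<noteq> 0 \<or> v \<noteq> 0"
    by (rule point_cases)
  show ?thesis
    unfolding uv(1) moebius_point[OF uv(2)]
      moebius_point[OF det_nonzero_imp_image_nonzero[OF assms uv(2)]]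
    by (simp add: matrix_matrix_mult_def sum_2 algebra_simps)
qed

section \<open>Topology of the sphere and continuity of Moebius maps\<close>

lemma openin_riemann_sphere_vimage:
  "openin riemann_sphere V \<longleftrightarrow> open (Some -` V) \<and> (None \<in> V \<longrightarrow> bounded (- (Some -` V)))"
proof
  assume "openin riemann_sphere V"
  then consider U' where "open U'" "V = Some ` U'"
    | C where "compact C" "V = insert None (Some ` (- C))"
    by (auto simp: riemann_sphere_def openin_Alexandroff_compactification Compl_eq_Diff_UNIV)
  then show "open (Some -` V) \<and> (None \<in> V \<longrightarrow> bounded (- (Some -` V)))"
  proof cases
    case 1
    then have "Some -` V = U'" by auto
    then show ?thesis using 1 by auto
  next
    case 2
    then have "Some -` V = - C" by auto
    then show ?thesis using 2 by (simp add: compact_imp_bounded compact_imp_closed open_Compl)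
  qed
next
  assume U: "open (Some -` V) \<and> (None \<in> V \<longrightarrow> bounded (- (Some -` V)))"
  show "openin riemann_sphere V"
  proof (cases "None \<in> V")
    case True
    have "p \<in> V \<longleftrightarrow> p \<in> insert None (Some ` (UNIV - - (Some -` V)))" for p
      using True by (cases p) auto
    then have V: "V = insert None (Some ` (UNIV - - (Some -` V)))" by blast
    have "compact (- (Some -` V))"
      using U True by (simp add: compact_eq_bounded_closed closed_Compl)
    then show ?thesis
      unfolding riemann_sphere_def openin_Alexandroff_compactification
      by (intro disjI2 exI[of _ "- (Some -` V)"] conjI)
        (use V in \<open>simp_all add: compact_imp_closed\<close>)
  next
    case False
    have "p \<in> V \<longleftrightarrow> p \<in> Some ` (Some -` V)" for p
      using False by (cases p) auto
    then have "V = Some ` (Some -` V)" by blast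
    then show ?thesis
      using U unfolding riemann_sphere_def openin_Alexandroff_compactification by auto
  qed
qed

lemma openin_riemann_sphere:
  "openin riemann_sphere V \<longleftrightarrow>
    (\<forall>z. Some z \<in> V \<longrightarrow> (\<forall>\<^sub>F y in nhds z. Some y \<in> V)) \<and>
    (None \<in> V \<longrightarrow> (\<forall>\<^sub>F y in at_infinity. Some y \<in> V))"
proof -
  have "open (Some -` V) \<longleftrightarrow> (\<forall>z. Some z \<in> V \<longrightarrow> (\<forall>\<^sub>F y in nhds z. Some y \<in> V))"
    by (subst open_subopen) (simp add: eventually_nhds subset_iff Ball_def)
  moreover have "bounded (- (Some -` V)) \<longleftrightarrow> (\<forall>\<^sub>F y in at_infinity. Some y \<in> V)"
  proof
    assume "bounded (- (Some -` V))"
    then obtain B where "\<And>x. Some x \<notin> V \<Longrightarrow> norm x \<le> B" by (auto simp: bounded_iff)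
    then have "\<forall>x. norm x \<ge> B + 1 \<longrightarrow> Some x \<in> V" by fastforce
    then show "\<forall>\<^sub>F y in at_infinity. Some y \<in> V"
      unfolding eventually_at_infinity by blast
  next
    assume "\<forall>\<^sub>F y in at_infinity. Some y \<in> V"
    then obtain B where "\<And>x. norm x \<ge> B \<Longrightarrow> Some x \<in> V"
      unfolding eventually_at_infinity by blast
    then have "\<forall>x \<in> - (Some -` V). norm x \<le> B"
      by (metis ComplD linear vimageI)
    then show "bounded (- (Some -` V))"
      unfolding bounded_iff by blast
  qed
  ultimately show ?thesis by (simp add: openin_riemann_sphere_vimage)
qed

lemma topspace_riemann_sphere [simp]: "topspace riemann_sphere = UNIV"
  by (auto simp: riemann_sphere_def) (metis not_None_eq rangeI)

text \<open>Continuity of the passage from homogeneous coordinates to the sphere. Stated for an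
  arbitrary filter, it covers continuity of a Moebius map both at finite points and at
  infinity.\<close>

lemma eventually_point_mem:
  assumes "(u \<longlongrightarrow> u0) F" "(v \<longlongrightarrow> v0) F" "u0 \<noteq> 0 \<or> v0 \<noteq> 0"
    and V: "openin riemann_sphere V" "point u0 v0 \<in> V"
  shows "\<forall>\<^sub>F y in F. point (u y) (v y) \<in> V"
proof (cases "v0 = 0")
  case False
  then have lim: "((\<lambda>y. u y / v y) \<longlongrightarrow> u0 / v0) F"
    by (intro tendsto_divide assms)
  have "\<forall>\<^sub>F y in nhds (u0 / v0). Some y \<in> V"
    using V False by (auto simp: openin_riemann_sphere point_def)
  then have "\<forall>\<^sub>F y in F. Some (u y / v y) \<in> V"
    using lim by (rule eventually_compose_filterlim)
  moreover have "\<forall>\<^sub>F y in F. v y \<noteq> 0"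
    using assms(2) False by (rule tendsto_imp_eventually_ne)
  ultimately show ?thesis
    by eventually_elim (simp add: point_def)
next
  case True
  then have "None \<in> V" using V by (simp add: point_def)
  then obtain B where B: "\<And>y. norm y \<ge> B \<Longrightarrow> Some y \<in> V"
    using V by (auto simp: openin_riemann_sphere eventually_at_infinity)
  \<comment> \<open>The inequality \<open>norm u > B * norm v\<close> expresses that
    \<open>u / v\<close> is large without dividing, so it tolerates zeros of \<open>v\<close> along
    the filter.\<close>
  have "((\<lambda>y. norm (u y) - B * norm (v y)) \<longlongrightarrow> norm u0 - B * norm v0) F"
    by (intro tendsto_intros assms)
  moreover have "norm u0 - B * norm v0 > 0"
    using True assms(3) by simp
  ultimately have "\<forall>\<^sub>F y in F. norm (u y) - B * norm (v y) > 0"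
    by (rule order_tendstoD)
  then show ?thesis
  proof eventually_elim
    case (elim y)
    show ?case
    proof (cases "v y = 0")
      case False
      then have "norm (u y / v y) \<ge> B"
        using elim by (simp add: norm_divide pos_le_divide_eq)
      then show ?thesis using B False by (simp add: point_def)
    qed (use \<open>None \<in> V\<close> in \<open>simp add: point_def\<close>)
  qed
qed

lemma continuous_map_moebius:
  fixes M :: "complex^2^2"
  assumes "det M \<noteq> 0"
  shows "continuous_map riemann_sphere riemann_sphere (moebius M)"
  unfolding continuous_map_def
proof (intro conjI allI impI)
  fix V assume V: "openin riemann_sphere V"
  have "\<forall>\<^sub>F y in nhds z. moebius M (Some y) \<in> V" if z: "moebius M (Some z) \<in> V" for z
  proof -
    have "\<forall>\<^sub>F y in nhds z. point (M$1$1 * y + M$1$2 * 1) (M$2$1 * y + M$2$2 * 1) \<in> V"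
    proof (rule eventually_point_mem[OF _ _ _ V])
      show "point (M$1$1 * z + M$1$2 * 1) (M$2$1 * z + M$2$2 * 1) \<in> V"
        using z moebius_point[of z 1 M] by (simp add: Some_eq_point)
      show "M$1$1 * z + M$1$2 * 1 \<noteq> 0 \<or> M$2$1 * z + M$2$2 * 1 \<noteq> 0"
        by (rule det_nonzero_imp_image_nonzero[OF assms]) simp
    qed (intro tendsto_intros filterlim_ident)+
    then show ?thesis
      by (simp add: Some_eq_point moebius_point)
  qed
  moreover have "\<forall>\<^sub>F y in at_infinity. moebius M (Some y) \<in> V" if "moebius M None \<in> V"
  proof -
    \<comment> \<open>Near infinity \<open>y\<close> is written as
      \<open>point 1 (inverse y)\<close>, whose coordinates converge to those of
      \<open>None\<close>.\<close>
    have "\<forall>\<^sub>F y in at_infinity.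
        point (M$1$1 * 1 + M$1$2 * inverse y) (M$2$1 * 1 + M$2$2 * inverse y) \<in> V"
    proof (rule eventually_point_mem[OF _ _ _ V])
      show "point (M$1$1 * 1 + M$1$2 * 0) (M$2$1 * 1 + M$2$2 * 0) \<in> V"
        using that moebius_point[of 1 0 M] by (simp add: None_eq_point)
      show "M$1$1 * 1 + M$1$2 * 0 \<noteq> 0 \<or> M$2$1 * 1 + M$2$2 * 0 \<noteq> 0"
        by (rule det_nonzero_imp_image_nonzero[OF assms]) simp
    qed (intro tendsto_intros tendsto_inverse_0)+
    moreover have "\<forall>\<^sub>F y::complex in at_infinity. y \<noteq> 0"
      unfolding eventually_at_infinity by (intro exI[of _ 1]) auto
    ultimately show ?thesis
    proof eventually_elim
      case (elim y)
      have "Some y = point 1 (inverse y)"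
        using elim by (simp add: point_def divide_inverse)
      then show ?case using elim(1) moebius_point[of 1 "inverse y" M] by simp
    qed
  qed
  ultimately show "openin riemann_sphere {p \<in> topspace riemann_sphere. moebius M p \<in> V}"
    unfolding openin_riemann_sphere by simp
qed simp

text \<open>The adjugate. For determinant 1 it is the inverse matrix, and its entries stay in the
  ring.\<close>

definition adj :: "complex^2^2 \<Rightarrow> complex^2^2" where
  "adj M = vector [vector [M$2$2, - M$1$2], vector [- M$2$1, M$1$1]]"

lemma adj_nth [simp]:
  "adj M $ 1 $ 1 = M$2$2" "adj M $ 1 $ 2 = - M$1$2" "adj M $ 2 $ 1 = - M$2$1" "adj M $ 2 $ 2 = M$1$1"
  by (simp_all add: adj_def)

lemma det_adj [simp]: "det (adj M) = det M"
  by (simp add: det_2 mult.commute)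

lemma adj_adj [simp]: "adj (adj M) = M"
  by (simp add: vec_eq_iff forall_2)

lemma moebius_adj:
  assumes "det M = 1"
  shows "moebius (adj M) (moebius M p) = p" "moebius M (moebius (adj M) p) = p"
proof -
  have *: "moebius (adj N) (moebius N p) = p" if "det N = 1" for N
  proof -
    obtain u v where uv: "p = point u v" "u \<noteq> 0 \<or> v \<noteq> 0"
      by (rule point_cases)
    have "N$2$2 * (N$1$1 * u + N$1$2 * v) + - N$1$2 * (N$2$1 * u + N$2$2 * v) = det N * u"
      "- N$2$1 * (N$1$1 * u + N$1$2 * v) + N$1$1 * (N$2$1 * u + N$2$2 * v) = det N * v"
      by (simp_all add: det_2 algebra_simps)
    moreover have "N$1$1 * u + N$1$2 * v \<noteq> 0 \<or> N$2$1 * u + N$2$2 * v \<noteq> 0"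
      using uv that by (intro det_nonzero_imp_image_nonzero) auto
    ultimately show ?thesis
      unfolding uv(1) moebius_point[OF uv(2)] using that by (subst moebius_point) simp_all
  qed
  show "moebius (adj M) (moebius M p) = p" using *[OF assms] .
  show "moebius M (moebius (adj M) p) = p" using *[of "adj M"] assms by simp
qed

lemma bij_moebius: "bij (moebius M)" if "det M = 1"
  by (rule bij_betw_byWitness[where f' = "moebius (adj M)"]) (use moebius_adj that in auto)

lemma open_moebius_image:
  assumes "det M = 1" "openin riemann_sphere V"
  shows "openin riemann_sphere (moebius M ` V)"
proof -
  have "moebius M ` V = {p \<in> topspace riemann_sphere. moebius (adj M) p \<in> V}"
    by (auto simp: moebius_adj[OF assms(1)]) (metis moebius_adj(2)[OF assms(1)] image_eqI)
  then show ?thesis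
    using continuous_map_moebius[of "adj M"] assms by (auto simp: continuous_map_def)
qed

section \<open>Half-planes and the two sides of a circle\<close>

definition upper :: "complex option set" where
  "upper = Some ` {z. Im z > 0}"

definition lower :: "complex option set" where
  "lower = Some ` {z. Im z < 0}"

text \<open>\<open>Im (u / v)\<close> is \<open>Im (u * cnj v)\<close> divided by a positive number.
  For \<open>v = 0\<close> the latter vanishes, in accordance with infinity lying on the extended
  real line.\<close>

lemma point_mem_iff:
  assumes "u \<noteq> 0 \<or> v \<noteq> 0"
  shows "point u v \<in> upper \<longleftrightarrow> Im (u * cnj v) > 0"
    "point u v \<in> lower \<longleftrightarrow> Im (u * cnj v) < 0"
    "point u v \<in> extended_reals \<longleftrightarrow> Im (u * cnj v) = 0"
proof -
  have *: "Im (u / v) = Im (u * cnj v) / (norm v)\<^sup>2" if "v \<noteq> 0"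
    by (simp add: Im_divide cmod_power2)
  show "point u v \<in> upper \<longleftrightarrow> Im (u * cnj v) > 0"
    using * by (auto simp: upper_def point_def zero_less_divide_iff)
  show "point u v \<in> lower \<longleftrightarrow> Im (u * cnj v) < 0"
    using * by (auto simp: lower_def point_def divide_less_0_iff)
  show "point u v \<in> extended_reals \<longleftrightarrow> Im (u * cnj v) = 0"
    using * by (auto simp: extended_reals_def point_def image_iff complex_is_Real_iff)
qed

lemma halfplanes_partition:
  "upper \<inter> lower = {}" "upper \<inter> extended_reals = {}" "lower \<inter> extended_reals = {}"
  "upper \<union> lower = - extended_reals" "upper \<noteq> {}" "lower \<noteq> {}"
proof -
  show "upper \<inter> lower = {}" "upper \<inter> extended_reals = {}" "lower \<inter> extended_reals = {}"
    by (auto simp: upper_def lower_def extended_reals_def complex_is_Real_iff)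
  show "upper \<union> lower = - extended_reals"
  proof (rule set_eqI)
    fix p
    obtain u v where "p = point u v" "u \<noteq> 0 \<or> v \<noteq> 0"
      by (rule point_cases)
    then show "p \<in> upper \<union> lower \<longleftrightarrow> p \<in> - extended_reals"
      by (auto simp: point_mem_iff)
  qed
  have "Some \<i> \<in> upper" "Some (- \<i>) \<in> lower"
    unfolding upper_def lower_def by (auto simp: image_iff)
  then show "upper \<noteq> {}" "lower \<noteq> {}" by blast+
qed

lemma open_connected_halfplanes:
  "openin riemann_sphere upper" "openin riemann_sphere lower"
  "connectedin riemann_sphere upper" "connectedin riemann_sphere lower"
proof -
  show "openin riemann_sphere upper" "openin riemann_sphere lower"
    by (auto simp: riemann_sphere_def upper_def lower_def open_halfspace_Im_gt open_halfspace_Im_lt)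
  have *: "connectedin riemann_sphere (Some ` A)" if "convex A" for A :: "complex set"
    using connectedin_continuous_map_image[OF continuous_map_Some, of euclidean A] that
    by (simp add: riemann_sphere_def convex_connected)
  show "connectedin riemann_sphere upper" "connectedin riemann_sphere lower"
    unfolding upper_def lower_def
    by (auto intro!: * convex_halfspace_Im_gt convex_halfspace_Im_lt)
qed

text \<open>Each of the two sets is connected, hence inside one component; a component meeting both
  would be split by these open sets.\<close>

lemma connected_components_of_eq_doubleton:
  assumes "openin X A" "openin X B" "connectedin X A" "connectedin X B"
    and "A \<inter> B = {}" "A \<union> B = topspace X" "A \<noteq> {}" "B \<noteq> {}"
  shows "connected_components_of X = {A, B}"
proof -
  have *: "connected_component_of_set X x = A'"
    if x: "x \<in> A'" and A': "openin X A'" "openin X B'" "connectedin X A'" "A' \<inter> B' = {}"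
      "A' \<union> B' = topspace X" for x A' B'
  proof
    show "A' \<subseteq> connected_component_of_set X x"
      using A'(3) x by (rule connected_component_of_maximal)
    show "connected_component_of_set X x \<subseteq> A'"
    proof (rule ccontr)
      assume "\<not> ?thesis"
      then have "connected_component_of_set X x \<inter> B' \<noteq> {}"
        using connected_component_of_subset_topspace[of X x] A'(5) by blast
      moreover have "x \<in> connected_component_of_set X x"
        using x A'(5) by (auto simp: connected_component_of_refl)
      moreover have "connectedin X (connected_component_of_set X x)"
        by (rule connectedin_connected_component_of)
      ultimately show False
        using A' x connected_component_of_subset_topspace[of X x] unfolding connectedin
        by (metis disjoint_iff inf_assoc inf_bot_right)
    qed
  qed
  have A: "connected_component_of_set X x = A" if "x \<in> A" for x
    using that assms by (intro *[of _ A B]) auto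
  have B: "connected_component_of_set X x = B" if "x \<in> B" for x
    using that assms by (intro *[of _ B A]) auto
  have "connected_component_of_set X ` A = {A}" "connected_component_of_set X ` B = {B}"
    using A B assms(7,8) by (simp_all add: image_constant_conv cong: image_cong)
  then show ?thesis
    unfolding connected_components_of_def assms(6)[symmetric] image_Un by auto
qed

text \<open>A Moebius map of determinant 1 is a bijection, continuous and open, so the images of the
  half-planes are again open, connected and complementary to the circle.\<close>

lemma complementary_regions_moebius:
  assumes "det M = 1"
  shows "complementary_regions (moebius M ` extended_reals) = {moebius M ` upper, moebius M ` lower}"
proof -
  have bij: "bij (moebius M)" using assms by (rule bij_moebius)
  then have inj: "inj (moebius M)" by (rule bij_is_inj)
  let ?S = "- (moebius M ` extended_reals)"
  have part: "moebius M ` upper \<union> moebius M ` lower = ?S"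
    unfolding image_Un[symmetric] halfplanes_partition(4) by (rule bij_image_Compl_eq[OF bij])
  have cont: "continuous_map riemann_sphere riemann_sphere (moebius M)"
    using assms by (intro continuous_map_moebius) simp
  have con: "connectedin riemann_sphere (moebius M ` upper)"
    "connectedin riemann_sphere (moebius M ` lower)"
    using open_connected_halfplanes connectedin_continuous_map_image[OF cont] by blast+
  have op: "openin riemann_sphere (moebius M ` upper)" "openin riemann_sphere (moebius M ` lower)"
    using open_connected_halfplanes open_moebius_image[OF assms] by blast+
  show ?thesis
    unfolding complementary_regions_def
  proof (rule connected_components_of_eq_doubleton)
    show "moebius M ` upper \<inter> moebius M ` lower = {}"
      unfolding image_Int[OF inj, symmetric] halfplanes_partition(1) by simp
    show "moebius M ` upper \<union> moebius M ` lower = topspace (subtopology riemann_sphere ?S)"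
      using part by simp
    show "openin (subtopology riemann_sphere ?S) (moebius M ` upper)"
      "openin (subtopology riemann_sphere ?S) (moebius M ` lower)"
      unfolding openin_subtopology using op part by blast+
    show "connectedin (subtopology riemann_sphere ?S) (moebius M ` upper)"
      "connectedin (subtopology riemann_sphere ?S) (moebius M ` lower)"
      unfolding connectedin_subtopology using con part by blast+
  qed (use halfplanes_partition(5,6) in simp_all)
qed

section \<open>Images of real points and the associated quadratic form\<close>

definition mat2 :: "complex \<Rightarrow> complex \<Rightarrow> complex \<Rightarrow> complex \<Rightarrow> complex^2^2" where
  "mat2 a b c d = vector [vector [a, b], vector [c, d]]"

lemma mat2_nth [simp]:
  "mat2 a b c d $ 1 $ 1 = a" "mat2 a b c d $ 1 $ 2 = b"
  "mat2 a b c d $ 2 $ 1 = c" "mat2 a b c d $ 2 $ 2 = d"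
  by (simp_all add: mat2_def)

lemma SL2_iff:
  "M \<in> SL2 R \<longleftrightarrow> M$1$1 \<in> R \<and> M$1$2 \<in> R \<and> M$2$1 \<in> R \<and> M$2$2 \<in> R \<and>
    M$1$1 * M$2$2 - M$1$2 * M$2$1 = 1"
  unfolding SL2_def mem_Collect_eq forall_2 det_2 by (simp only: conj_assoc)

lemma det_SL2: "det M = 1" if "M \<in> SL2 R"
  using that unfolding SL2_def by blast

lemma point_scale: "k \<noteq> 0 \<Longrightarrow> point (k * u) (k * v) = point u v"
  by (simp add: point_def)

lemma extended_reals_cases:
  assumes "p \<in> extended_reals"
  obtains x y :: real where "p = point (of_real x) (of_real y)" "x \<noteq> 0 \<or> y \<noteq> 0"
proof (cases p)
  case None
  then show ?thesis using that[of 1 0] by (simp add: point_def)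
next
  case (Some z)
  then have "of_real (Re z) = z"
    using assms by (auto simp: extended_reals_def complex_is_Real_iff complex_eq_iff)
  then show ?thesis using that[of "Re z" 1] Some by (simp add: point_def)
qed

lemma point_of_real_mem: "x \<noteq> 0 \<or> y \<noteq> 0 \<Longrightarrow> point (of_real x) (of_real y) \<in> extended_reals"
  by (subst point_mem_iff) auto

lemma moebius_point_of_real:
  assumes "x \<noteq> 0 \<or> y \<noteq> 0"
  shows "moebius M (point (of_real x) (of_real y)) =
    point (M$1$1 * of_real x + M$1$2 * of_real y) (M$2$1 * of_real x + M$2$2 * of_real y)"
  using assms by (intro moebius_point) simp

text \<open>By \<open>point_mem_iff\<close> the sign of this real binary quadratic form tells on
  which side of the real line the image of the point \<open>[x : y]\<close> lies.\<close>

lemma Im_form: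
  fixes x y :: real
  shows "Im ((a * of_real x + b * of_real y) * cnj (c * of_real x + d * of_real y)) =
    Im (a * cnj c) * x\<^sup>2 + Im (a * cnj d + b * cnj c) * x * y + Im (b * cnj d) * y\<^sup>2"
  by (simp add: algebra_simps power2_eq_square)

lemma moebius_real_mem_iff:
  fixes x y :: real
  assumes "det M = 1" "x \<noteq> 0 \<or> y \<noteq> 0"
  defines "q \<equiv> Im (M$1$1 * cnj (M$2$1)) * x\<^sup>2 +
    Im (M$1$1 * cnj (M$2$2) + M$1$2 * cnj (M$2$1)) * x * y + Im (M$1$2 * cnj (M$2$2)) * y\<^sup>2"
  shows "moebius M (point (of_real x) (of_real y)) \<in> upper \<longleftrightarrow> q > 0"
    "moebius M (point (of_real x) (of_real y)) \<in> lower \<longleftrightarrow> q < 0"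
    "moebius M (point (of_real x) (of_real y)) \<in> extended_reals \<longleftrightarrow> q = 0"
proof -
  have nz: "M$1$1 * of_real x + M$1$2 * of_real y \<noteq> 0 \<or> M$2$1 * of_real x + M$2$2 * of_real y \<noteq> 0"
    using assms by (intro det_nonzero_imp_image_nonzero) auto
  show "moebius M (point (of_real x) (of_real y)) \<in> upper \<longleftrightarrow> q > 0"
    "moebius M (point (of_real x) (of_real y)) \<in> lower \<longleftrightarrow> q < 0"
    "moebius M (point (of_real x) (of_real y)) \<in> extended_reals \<longleftrightarrow> q = 0"
    unfolding moebius_point_of_real[OF assms(2)] point_mem_iff[OF nz] Im_form q_def by (rule refl)+
qed

text \<open>The inclusion says that the quadratic form of \<open>M\<close> vanishes identically.
  Then so does the form of \<open>adj M\<close>, so the inverse also maps the extended reals into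
  themselves.\<close>

lemma moebius_extended_reals_eqI:
  assumes det: "det M = 1" and sub: "moebius M ` extended_reals \<subseteq> extended_reals"
  shows "moebius M ` extended_reals = extended_reals"
proof -
  define a b c d where abcd: "a = M$1$1" "b = M$1$2" "c = M$2$1" "d = M$2$2"
  have mem: "moebius M (point (of_real x) (of_real y)) \<in> extended_reals" if "x \<noteq> 0 \<or> y \<noteq> 0" for x y :: real
    using sub point_of_real_mem[OF that] by blast
  have q: "Im (a * cnj c) * x\<^sup>2 + Im (a * cnj d + b * cnj c) * x * y + Im (b * cnj d) * y\<^sup>2 = 0"
    if "x \<noteq> 0 \<or> y \<noteq> 0" for x y
    using moebius_real_mem_iff(3)[OF det that] mem[OF that] by (simp only: abcd)
  have Im0: "Im (a * cnj c) = 0" "Im (b * cnj d) = 0" "Im (a * cnj d + b * cnj c) = 0"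
    using q[of 1 0] q[of 0 1] q[of 1 1] by auto
  have cnj_eq: "cnj z = z" if "Im z = 0" for z using that by (simp add: complex_eq_iff)
  \<comment> \<open>Conjugates become independent symbols, so that what follows is polynomial
    algebra.\<close>
  define a' b' c' d' where "a' = cnj a" "b' = cnj b" "c' = cnj c" "d' = cnj d"
  note abcd' = this
  have H: "a * c' = a' * c" "b * d' = b' * d" "a * d' + b * c' = a' * d + b' * c"
    using Im0[THEN cnj_eq] by (simp_all add: abcd' mult.commute)
  have D: "a * d - b * c = 1" using det by (simp add: abcd det_2)
  \<comment> \<open>These equations say that the coefficients of the form of \<open>adj M\<close>
    vanish. Multiplied by the determinant 1, each difference of sides is a combination of those in
    \<open>H\<close>.\<close>
  have G: "d * c' = d' * c" "b * a' = b' * a" "d * a' + b * c' = d' * a + b' * c"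
  proof -
    have "d * c' - d' * c = (a * d - b * c) * (d * c' - d' * c)"
      "b * a' - b' * a = (a * d - b * c) * (b * a' - b' * a)"
      "d * a' + b * c' - (d' * a + b' * c) = (a * d - b * c) * (d * a' + b * c' - (d' * a + b' * c))"
      unfolding D by simp_all
    moreover have "(a * d - b * c) * (d * c' - d' * c) = d * d * (a * c' - a' * c)
        + c * c * (b * d' - b' * d) - c * d * (a * d' + b * c' - (a' * d + b' * c))"
      "(a * d - b * c) * (b * a' - b' * a) = b * b * (a * c' - a' * c)
        + a * a * (b * d' - b' * d) - a * b * (a * d' + b * c' - (a' * d + b' * c))"
      "(a * d - b * c) * (d * a' + b * c' - (d' * a + b' * c)) = 2 * (b * d * (a * c' - a' * c)
        + a * c * (b * d' - b' * d)) - (a * d + b * c) * (a * d' + b * c' - (a' * d + b' * c))"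
      by (simp_all add: algebra_simps)
    ultimately show "d * c' = d' * c" "b * a' = b' * a" "d * a' + b * c' = d' * a + b' * c"
      unfolding H by (simp_all only: diff_self mult_zero_right add_0 eq_iff_diff_eq_0[of "_ * _"] eq_iff_diff_eq_0[of "_ + _"])
  qed
  have Im_eq: "Im z = 0" if "cnj z = z" for z
    using that by (simp add: complex_eq_iff)
  have G': "Im (d * cnj (- c)) = 0" "Im (- b * cnj a) = 0" "Im (d * cnj a + - b * cnj (- c)) = 0"
    by (rule Im_eq; use G in \<open>simp add: abcd' mult.commute add.commute\<close>)+
  have "p \<in> moebius M ` extended_reals" if p_mem: "p \<in> extended_reals" for p
  proof -
    obtain x y where p: "p = point (of_real x) (of_real y)" "x \<noteq> 0 \<or> y \<noteq> 0"
      using p_mem by (rule extended_reals_cases)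
    have "moebius (adj M) p \<in> extended_reals"
      using moebius_real_mem_iff(3)[of "adj M", OF _ p(2)] det G' unfolding p(1) by (simp add: abcd)
    then show ?thesis
      using moebius_adj(2)[OF det] by (metis image_eqI)
  qed
  then show ?thesis using sub by blast
qed

text \<open>Completing the square shows that \<open>A\<close> times any value and \<open>C\<close>
  times any value is nonnegative. Values of both signs force \<open>A = C = 0\<close>, then
  \<open>B = 0\<close>, and the form vanishes.\<close>

lemma quadratic_form_semidefinite:
  fixes A B C x y u v :: real
  assumes "B\<^sup>2 \<le> 4 * A * C" "A * x\<^sup>2 + B * x * y + C * y\<^sup>2 > 0" "A * u\<^sup>2 + B * u * v + C * v\<^sup>2 < 0"
  shows False
proof -
  have A: "A * (A * x\<^sup>2 + B * x * y + C * y\<^sup>2) \<ge> 0" for x y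
  proof -
    have "4 * (A * (A * x\<^sup>2 + B * x * y + C * y\<^sup>2)) = (2 * A * x + B * y)\<^sup>2 + (4 * A * C - B\<^sup>2) * y\<^sup>2"
      by (simp add: power2_eq_square algebra_simps)
    moreover have "(4 * A * C - B\<^sup>2) * y\<^sup>2 \<ge> 0" using assms(1) by simp
    ultimately show ?thesis by (smt (verit) zero_le_power2)
  qed
  have C: "C * (A * x\<^sup>2 + B * x * y + C * y\<^sup>2) \<ge> 0" for x y
  proof -
    have "4 * (C * (A * x\<^sup>2 + B * x * y + C * y\<^sup>2)) = (2 * C * y + B * x)\<^sup>2 + (4 * A * C - B\<^sup>2) * x\<^sup>2"
      by (simp add: power2_eq_square algebra_simps)
    moreover have "(4 * A * C - B\<^sup>2) * x\<^sup>2 \<ge> 0" using assms(1) by simp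
    ultimately show ?thesis by (smt (verit) zero_le_power2)
  qed
  have "A \<ge> 0" "C \<ge> 0"
    using A[of x y] C[of x y] assms(2) by (simp_all add: zero_le_mult_iff)
  moreover have "A \<le> 0" "C \<le> 0"
    using A[of u v] C[of u v] assms(3) by (simp_all add: zero_le_mult_iff)
  ultimately have "A = 0" "C = 0" by auto
  then show False using assms by simp
qed

context quadratic_order
begin


lemma SL2_mult: "M ** N \<in> SL2 R" if "M \<in> SL2 R" "N \<in> SL2 R"
proof -
  have "(M ** N) $ i $ j = M$i$1 * N$1$j + M$i$2 * N$2$j" for i j
    by (simp add: matrix_matrix_mult_def sum_2)
  moreover have "M$i$1 * N$1$j + M$i$2 * N$2$j \<in> R" for i j
    using that by (intro add_mem mult_mem) (auto simp: SL2_def)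
  ultimately show ?thesis
    using that by (simp add: SL2_def det_mul)
qed

lemma minus_mem: "- x \<in> R" if "x \<in> R"
  using mult_mem[OF of_int_mem[of "-1"] that] by simp

lemma SL2_adj: "adj M \<in> SL2 R" if "M \<in> SL2 R"
  using that by (simp add: SL2_iff minus_mem mult.commute)

lemma discriminant_nonpos:
  assumes M: "M \<in> SL2 R"
  shows "(Im (M$1$1 * cnj (M$2$2) + M$1$2 * cnj (M$2$1)))\<^sup>2
    \<le> 4 * Im (M$1$1 * cnj (M$2$1)) * Im (M$1$2 * cnj (M$2$2))"
proof -
  define a b c d where abcd: "a = M$1$1" "b = M$1$2" "c = M$2$1" "d = M$2$2"
  have R: "a \<in> R" "b \<in> R" "c \<in> R" "d \<in> R" and D: "a * d - b * c = 1"
    using M by (auto simp: SL2_iff abcd)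
  obtain k l m n :: int where Im: "Im a = k * Im w" "Im b = l * Im w" "Im c = m * Im w" "Im d = n * Im w"
    using R Im_mem by metis
  define t where "t = Re (a * cnj d - b * cnj c)"
  have "t = Re (a * d - b * c) + 2 * (Im a * Im d - Im b * Im c)"
    by (simp add: t_def algebra_simps)
  also have "\<dots> = 1 + 2 * ((k * n - l * m) * (Im w)\<^sup>2)"
    unfolding D Im by (simp add: power2_eq_square algebra_simps)
  finally have t: "t = 1 + 2 * (of_int (k * n - l * m) * (Im w)\<^sup>2)" by simp
  have w2: "(Im w)\<^sup>2 \<ge> 1" using Im_w by simp
  have "\<bar>t\<bar> \<ge> 1"
  proof (cases "k * n - l * m \<ge> 0")
    case True
    then have "of_int (k * n - l * m) * (Im w)\<^sup>2 \<ge> 0"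
      by (intro mult_nonneg_nonneg) (simp_all only: of_int_0_le_iff zero_le_power2)
    then show ?thesis unfolding t by linarith
  next
    \<comment> \<open>This is where \<open>Im w \<ge> 1\<close> is decisive: a negative integer
      factor gives \<open>t \<le> 1 - 2 * (Im w)\<^sup>2 \<le> -1\<close>.\<close>
    case False
    then have "real_of_int (k * n - l * m) \<le> - 1" by linarith
    then have "of_int (k * n - l * m) * (Im w)\<^sup>2 \<le> - 1 * (Im w)\<^sup>2"
      by (intro mult_right_mono) simp_all
    then show ?thesis using w2 unfolding t by linarith
  qed
  then have t2: "t\<^sup>2 \<ge> 1" by (simp add: abs_le_square_iff[of 1 t, simplified])
  \<comment> \<open>The discriminant of the form plus the square of \<open>t\<close> is the squared
    modulus of the determinant.\<close>
  have "(Im (a * cnj d + b * cnj c))\<^sup>2 - 4 * Im (a * cnj c) * Im (b * cnj d) + t\<^sup>2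
      = (Re (a * d - b * c))\<^sup>2 + (Im (a * d - b * c))\<^sup>2"
    by (simp add: t_def power2_eq_square algebra_simps)
  also have "\<dots> = 1" unfolding D by simp
  finally show ?thesis using t2 by (simp add: abcd)
qed

lemma real_image_one_sided:
  assumes "M \<in> SL2 R"
  shows "moebius M ` extended_reals \<inter> upper = {} \<or> moebius M ` extended_reals \<inter> lower = {}"
proof (rule ccontr)
  assume "\<not> ?thesis"
  then obtain p q where pq: "p \<in> extended_reals" "moebius M p \<in> upper" "q \<in> extended_reals" "moebius M q \<in> lower"
    by blast
  obtain x y where p: "p = point (of_real x) (of_real y)" "x \<noteq> 0 \<or> y \<noteq> 0"
    using pq(1) by (rule extended_reals_cases)
  obtain u v where q: "q = point (of_real u) (of_real v)" "u \<noteq> 0 \<or> v \<noteq> 0"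
    using pq(3) by (rule extended_reals_cases)
  note det = det_SL2[OF assms]
  show False
    using quadratic_form_semidefinite[OF discriminant_nonpos[OF assms]]
      moebius_real_mem_iff(1)[OF det p(2)] moebius_real_mem_iff(2)[OF det q(2)]
      pq(2,4) unfolding p(1) q(1) by blast
qed

end

section \<open>Horizontal lines and circles through infinity\<close>

definition translation :: "complex \<Rightarrow> complex^2^2" where
  "translation b = mat2 1 b 0 1"

lemma det_translation [simp]: "det (translation b) = 1"
  by (simp add: translation_def det_2)

lemma translation_nth [simp]:
  "translation b $ 1 $ 1 = 1" "translation b $ 1 $ 2 = b"
  "translation b $ 2 $ 1 = 0" "translation b $ 2 $ 2 = 1"
  by (simp_all add: translation_def)

lemma translation_images:
  "None \<notin> moebius (translation b) ` upper" "None \<notin> moebius (translation b) ` lower"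
  "None \<in> moebius (translation b) ` extended_reals"
  "Some z \<in> moebius (translation b) ` upper \<longleftrightarrow> Im z > Im b"
  "Some z \<in> moebius (translation b) ` lower \<longleftrightarrow> Im z < Im b"
  "Some z \<in> moebius (translation b) ` extended_reals \<longleftrightarrow> Im z = Im b"
proof -
  show "None \<notin> moebius (translation b) ` upper" "None \<notin> moebius (translation b) ` lower"
    by (auto simp: upper_def lower_def)
  show "None \<in> moebius (translation b) ` extended_reals"
    by (auto simp: extended_reals_def image_iff)
  have *: "Some z \<in> moebius (translation b) ` A \<longleftrightarrow> Some (z - b) \<in> A" for A
  proof
    assume "Some z \<in> moebius (translation b) ` A"
    then obtain p where p: "p \<in> A" "Some z = moebius (translation b) p" by blast
    then show "Some (z - b) \<in> A" by (cases p) auto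
  next
    assume "Some (z - b) \<in> A"
    moreover have "Some z = moebius (translation b) (Some (z - b))" by simp
    ultimately show "Some z \<in> moebius (translation b) ` A" by blast
  qed
  show "Some z \<in> moebius (translation b) ` upper \<longleftrightarrow> Im z > Im b"
    "Some z \<in> moebius (translation b) ` lower \<longleftrightarrow> Im z < Im b"
    "Some z \<in> moebius (translation b) ` extended_reals \<longleftrightarrow> Im z = Im b"
    unfolding * by (auto simp: upper_def lower_def extended_reals_def complex_is_Real_iff)
qed

lemma moebius_real_matrix:
  assumes "det M = 1" "\<And>i j. M$i$j \<in> \<real>"
  shows "moebius M ` extended_reals = extended_reals"
proof (rule moebius_extended_reals_eqI[OF assms(1)], rule image_subsetI)
  fix p assume "p \<in> extended_reals"
  then obtain x y where p: "p = point (of_real x) (of_real y)" "x \<noteq> 0 \<or> y \<noteq> 0"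
    by (rule extended_reals_cases)
  have im: "Im (M$i$j) = 0" for i j
    using assms(2) complex_is_Real_iff by blast
  show "moebius M p \<in> extended_reals"
    unfolding p(1) moebius_real_mem_iff(3)[OF assms(1) p(2)] by (simp add: im)
qed

lemma moebius_mult_image: "moebius (M ** N) ` A = moebius M ` moebius N ` A" if "det N = 1"
  using that by (simp add: image_image moebius_mult)

lemma adj_image: "moebius (adj M) ` moebius M ` A = A" "moebius M ` moebius (adj M) ` A = A"
  if "det M = 1"
  using moebius_adj[OF that] by (simp_all add: image_image)

context quadratic_order
begin

lemma norm_Ints: "x * cnj x \<in> \<int>" if "x \<in> R"
proof (rule real_mem)
  show "x * cnj x \<in> R" using that by (intro mult_mem cnj_mem)
  show "x * cnj x \<in> \<real>" by (simp add: complex_mult_cnj)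
qed

text \<open>Nonzero elements of \<open>R\<close> have modulus at least 1, so a unit lies on the unit
  circle. Its imaginary part is 0 or at least 1 in modulus, which leaves only the fourth roots of
  unity.\<close>

lemma unit_square:
  assumes "a \<in> R" "d \<in> R" "a * d = 1"
  shows "a * a = 1 \<or> a * a = -1"
proof -
  have ge: "norm x \<ge> 1" if x: "x \<in> R" "x \<noteq> 0" for x
  proof -
    obtain n where n: "x * cnj x = of_int n" using norm_Ints[OF x(1)] by (rule Ints_cases)
    have "of_real ((norm x)\<^sup>2) = x * cnj x" by (rule complex_norm_square)
    then have "of_real ((norm x)\<^sup>2) = (of_real (of_int n) :: complex)"
      unfolding n by simp
    then have n2: "(norm x)\<^sup>2 = of_int n"
      unfolding of_real_eq_iff .
    have "(norm x)\<^sup>2 > 0" using x(2) by simp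
    then have "(norm x)\<^sup>2 \<ge> 1" unfolding n2 by simp
    then show ?thesis using abs_le_square_iff[of 1 "norm x"] by simp
  qed
  have "norm a * norm d = 1" using assms(3) by (metis norm_mult norm_one)
  moreover have "norm a \<ge> 1" "norm d \<ge> 1"
    using assms by (auto intro!: ge)
  ultimately have "norm a \<le> 1"
    using mult_left_mono[of 1 "norm d" "norm a"] by simp
  with \<open>norm a \<ge> 1\<close> have "norm a = 1" by simp
  then have sq: "(Re a)\<^sup>2 + (Im a)\<^sup>2 = 1"
    using cmod_power2[of a] by simp
  obtain k where k: "Im a = of_int k * Im w" using Im_mem[OF assms(1)] ..
  have "Re a = 0 \<or> Im a = 0"
  proof (cases "k = 0")
    case False
    then have "\<bar>of_int k\<bar> * Im w \<ge> 1 * 1"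
      using Im_w by (intro mult_mono) auto
    then have "\<bar>Im a\<bar> \<ge> 1" using Im_w unfolding k by (simp add: abs_mult)
    then have "(Im a)\<^sup>2 \<ge> 1" using abs_le_square_iff[of 1 "Im a"] by simp
    moreover have "(Re a)\<^sup>2 \<ge> 0" by simp
    ultimately have "(Re a)\<^sup>2 = 0" using sq by linarith
    then show ?thesis by simp
  qed (simp add: k)
  then show ?thesis
    using sq by (auto simp: complex_eq_iff power2_eq_square)
qed

text \<open>A real zero of the linear form has rational ratio: \<open>cnj c * d\<close> is real,
  hence an integer \<open>m\<close>, and with the norm \<open>n\<close> of \<open>c\<close> the pair
  \<open>(m, -n)\<close> is a zero. Dividing by the gcd makes it coprime.\<close>

lemma isotropic_ratio:
  assumes "c \<in> R" "d \<in> R" and x: "x \<noteq> 0 \<or> y \<noteq> 0" "c * of_real x + d * of_real y = 0"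
  obtains p q :: int where "coprime p q" "c * of_int p + d * of_int q = 0"
proof (cases "c = 0")
  case True
  then show ?thesis using that[of 1 0] by simp
next
  case False
  then have y: "y \<noteq> 0" using x by auto
  obtain n where n: "c * cnj c = of_int n" using norm_Ints[OF assms(1)] by (rule Ints_cases)
  have n0: "n \<noteq> 0" using n False by auto
  have "cnj c * d * of_real y = cnj c * (c * of_real x + d * of_real y) - (c * cnj c) * of_real x"
    by (simp add: algebra_simps)
  also have "\<dots> = of_real (- (of_int n * x))"
    unfolding x(2) n by simp
  finally have "cnj c * d = of_real (- (of_int n * x)) / of_real y"
    using y by (simp only: nonzero_eq_divide_eq of_real_eq_0_iff not_False_eq_True)
  then have "cnj c * d \<in> \<real>" by simp
  then have "cnj c * d \<in> \<int>" using assms by (intro real_mem mult_mem cnj_mem)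
  then obtain m where m: "cnj c * d = of_int m" by (rule Ints_cases)
  have "c * of_int m = d * of_int n"
    unfolding m[symmetric] n[symmetric] by (simp only: mult_ac)
  then have eq: "c * of_int m + d * of_int (- n) = 0" by simp
  define g where "g = gcd m (- n)"
  have g0: "g \<noteq> 0" using n0 by (simp add: g_def)
  obtain p q where pq: "m = p * g" "- n = q * g" "coprime p q"
    using gcd_coprime_exists[of m "- n"] g0 unfolding g_def by blast
  have "(c * of_int p + d * of_int q) * of_int g = 0"
    using eq unfolding pq(1,2) by (simp add: algebra_simps)
  then have "c * of_int p + d * of_int q = 0" using g0 by simp
  then show ?thesis using that pq(3) by blast
qed

text \<open>The point of the real line sent to infinity is rational, so an integer matrix of
  determinant 1 moves it to infinity while keeping the real line. The composite is upper triangular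
  with units on the diagonal, hence acts on the real line as a translation up to sign.\<close>

lemma circle_through_infinity:
  assumes M: "M \<in> SL2 R" and None: "None \<in> moebius M ` extended_reals"
  obtains b where "b \<in> R" "moebius M ` extended_reals = moebius (translation b) ` extended_reals"
proof -
  note det = det_SL2[OF M]
  obtain p where "p \<in> extended_reals" "moebius M p = None" using None by force
  then obtain x y where xy: "moebius M (point (of_real x) (of_real y)) = None" "x \<noteq> 0 \<or> y \<noteq> 0"
    by (metis extended_reals_cases)
  have "M$2$1 * of_real x + M$2$2 * of_real y = 0"
    using xy(1) unfolding moebius_point_of_real[OF xy(2)] by (simp add: point_def split: if_splits)
  moreover have "M$2$1 \<in> R" "M$2$2 \<in> R" using M by (auto simp: SL2_iff)
  ultimately obtain p q where pq: "coprime p q" "M$2$1 * of_int p + M$2$2 * of_int q = 0"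
    using xy(2) isotropic_ratio by metis
  obtain u v where uv: "u * p + v * q = 1"
    using pq(1) bezout_int[of p q] by auto
  \<comment> \<open>The first column is the zero \<open>(p, q)\<close>, which kills the lower left
    entry of \<open>M ** N\<close>; the Bezout coefficients complete it to determinant 1.\<close>
  define N where "N = mat2 (of_int p) (of_int (- v)) (of_int q) (of_int u)"
  have "of_int (u * p + v * q) = (1 :: complex)" unfolding uv by simp
  then have N: "N \<in> SL2 R"
    unfolding SL2_iff N_def mat2_nth by (simp only: of_int_mem) (simp add: mult.commute)
  have NR: "moebius N ` extended_reals = extended_reals"
  proof (rule moebius_real_matrix[OF det_SL2[OF N]])
    have "\<forall>i j. N$i$j \<in> \<real>" by (simp add: forall_2 N_def)
    then show "N$i$j \<in> \<real>" for i j by blast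
  qed
  define L where "L = M ** N"
  have L: "L \<in> SL2 R" unfolding L_def by (rule SL2_mult[OF M N])
  have MRL: "moebius M ` extended_reals = moebius L ` extended_reals"
    unfolding L_def moebius_mult_image[OF det_SL2[OF N]] NR ..
  have L21: "L$2$1 = 0"
    using pq(2) by (simp add: L_def N_def matrix_matrix_mult_def sum_2)
  define a b where "a = L$1$1" "b = L$1$2"
  have ab: "a \<in> R" "b \<in> R" "L$2$2 \<in> R" and ad: "a * L$2$2 = 1"
    using L L21 by (auto simp: SL2_iff a_b_def)
  have a0: "a \<noteq> 0" using ad by auto
  obtain s :: real where s: "a * a = of_real s" "s = 1 \<or> s = -1"
    using unit_square[OF ab(1,3) ad] by (metis of_real_1 of_real_minus)
  have s2: "s * s = 1" "s \<noteq> 0" using s(2) by auto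
  \<comment> \<open>Scaling the homogeneous coordinates by \<open>a\<close> turns the diagonal into
    \<open>a * a = s\<close> and 1, and the real sign \<open>s\<close> is absorbed into the
    parameter \<open>x\<close>.\<close>
  have key: "moebius L (point (of_real x) (of_real y)) =
      moebius (translation (a * b)) (point (of_real (s * x)) (of_real y))" if xy: "x \<noteq> 0 \<or> y \<noteq> 0" for x y
  proof -
    have "moebius L (point (of_real x) (of_real y)) = point (a * of_real x + b * of_real y) (L$2$2 * of_real y)"
      unfolding moebius_point_of_real[OF xy] by (simp add: L21 a_b_def)
    also have "\<dots> = point (a * (a * of_real x + b * of_real y)) (a * (L$2$2 * of_real y))"
      by (rule point_scale[OF a0, symmetric])
    also have "\<dots> = point ((a * a) * of_real x + a * b * of_real y) ((a * L$2$2) * of_real y)"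
      by (simp only: algebra_simps)
    also have "\<dots> = moebius (translation (a * b)) (point (of_real (s * x)) (of_real y))"
      unfolding ad s(1) using xy s2 by (subst moebius_point_of_real) (auto simp: translation_def)
    finally show ?thesis .
  qed
  have "moebius L ` extended_reals = moebius (translation (a * b)) ` extended_reals"
  proof
    show "moebius L ` extended_reals \<subseteq> moebius (translation (a * b)) ` extended_reals"
    proof (rule image_subsetI)
      fix p assume "p \<in> extended_reals"
      then obtain x y where p: "p = point (of_real x) (of_real y)" "x \<noteq> 0 \<or> y \<noteq> 0"
        by (rule extended_reals_cases)
      show "moebius L p \<in> moebius (translation (a * b)) ` extended_reals"
        unfolding p(1) key[OF p(2)] using p(2) s2 by (intro imageI point_of_real_mem) auto
    qed
    show "moebius (translation (a * b)) ` extended_reals \<subseteq> moebius L ` extended_reals"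
    proof (rule image_subsetI)
      fix p assume "p \<in> extended_reals"
      then obtain x y where p: "p = point (of_real x) (of_real y)" "x \<noteq> 0 \<or> y \<noteq> 0"
        by (rule extended_reals_cases)
      have nz: "s * x \<noteq> 0 \<or> y \<noteq> 0" using p(2) s2 by auto
      have sx: "s * (s * x) = x" using s2(1) by (metis mult.assoc mult_1)
      have "moebius (translation (a * b)) p = moebius L (point (of_real (s * x)) (of_real y))"
        unfolding key[OF nz] p(1) sx ..
      then show "moebius (translation (a * b)) p \<in> moebius L ` extended_reals"
        using point_of_real_mem[OF nz] by blast
    qed
  qed
  then show ?thesis
    using that[of "a * b"] MRL mult_mem[OF ab(1,2)] by simp
qed

end


section \<open>Circles of the arrangement and their packings\<close>

lemma moebius_halfplanes_Un:
  assumes "det M = 1"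
  shows "moebius M ` upper \<union> moebius M ` lower = - (moebius M ` extended_reals)"
  unfolding image_Un[symmetric] halfplanes_partition(4)
  by (rule bij_image_Compl_eq[OF bij_moebius[OF assms]])

lemma moebius_translation_0: "moebius (translation 0) = id"
proof
  show "moebius (translation 0) p = id p" for p by (cases p) simp_all
qed

lemma Some_mem_extended_reals: "Some z \<in> extended_reals \<longleftrightarrow> Im z = 0"
  by (auto simp: extended_reals_def complex_is_Real_iff)

lemma None_mem_extended_reals: "None \<in> extended_reals"
  by (simp add: extended_reals_def)

lemma translation_real_line_disjoint:
  "Im b \<le> 0 \<Longrightarrow> moebius (translation b) ` extended_reals \<inter> upper = {}"
  "Im b \<ge> 0 \<Longrightarrow> moebius (translation b) ` extended_reals \<inter> lower = {}"
proof -
  have "Im z = Im b" if "Some z \<in> moebius (translation b) ` extended_reals" for z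
    using that translation_images(6) by blast
  then show "Im b \<le> 0 \<Longrightarrow> moebius (translation b) ` extended_reals \<inter> upper = {}"
    "Im b \<ge> 0 \<Longrightarrow> moebius (translation b) ` extended_reals \<inter> lower = {}"
    unfolding upper_def lower_def by force+
qed

text \<open>Bijectivity carries sides to sides and intersections to intersections. This permits
  moving a given circle to the real line.\<close>

lemma straddles_moebius:
  assumes "det M = 1" "det N = 1"
  shows "straddles ((`) (moebius M) ` P) (moebius (M ** N) ` extended_reals) \<longleftrightarrow>
    straddles P (moebius N ` extended_reals)"
proof -
  have "(\<Union>((`) (moebius M) ` P)) \<inter> moebius M ` A = moebius M ` (\<Union>P \<inter> A)" for A
    using bij_is_inj[OF bij_moebius[OF assms(1)]] by (auto dest: injD)
  moreover have "complementary_regions (moebius (M ** N) ` extended_reals) =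
      {moebius M ` moebius N ` upper, moebius M ` moebius N ` lower}"
    using complementary_regions_moebius[of "M ** N"] assms
    unfolding moebius_mult_image[OF assms(2)] by (simp add: det_mul)
  ultimately show ?thesis
    unfolding straddles_def complementary_regions_moebius[OF assms(2)] by simp
qed

context quadratic_order
begin

definition circles :: "complex option set set" where
  "circles = {moebius M ` extended_reals | M. M \<in> SL2 R}"

lemma circlesI: "M \<in> SL2 R \<Longrightarrow> moebius M ` extended_reals \<in> circles"
  by (auto simp: circles_def)

lemma circlesE:
  assumes "C \<in> circles"
  obtains M where "C = moebius M ` extended_reals" "M \<in> SL2 R"
  using assms by (auto simp: circles_def)

lemma circle_regions:
  assumes "C \<in> circles"
  obtains I E where "complementary_regions C = {I, E}" "I \<inter> E = {}" "I \<noteq> {}" "E \<noteq> {}"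
    "I \<union> E = - C"
proof -
  obtain M where C: "C = moebius M ` extended_reals" and M: "M \<in> SL2 R" using assms by (rule circlesE)
  have bij: "bij (moebius M)" using M by (intro bij_moebius det_SL2)
  show ?thesis
  proof
    show "complementary_regions C = {moebius M ` upper, moebius M ` lower}"
      unfolding C by (rule complementary_regions_moebius[OF det_SL2[OF M]])
    show "moebius M ` upper \<inter> moebius M ` lower = {}"
      unfolding image_Int[OF bij_is_inj[OF bij], symmetric] halfplanes_partition(1) by simp
    show "moebius M ` upper \<union> moebius M ` lower = - C"
      unfolding C by (rule moebius_halfplanes_Un[OF det_SL2[OF M]])
  qed (simp_all add: halfplanes_partition)
qed

text \<open>The matrix \<open>adj N\<close> moves \<open>D\<close> to the real line, where
  \<open>real_image_one_sided\<close> applies to the image of \<open>C\<close>.\<close>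

lemma circles_do_not_cross:
  assumes "C \<in> circles" "D \<in> circles"
    and UV: "complementary_regions D = {U, V}"
  shows "C \<inter> U = {} \<or> C \<inter> V = {}"
proof -
  obtain M where C: "C = moebius M ` extended_reals" "M \<in> SL2 R"
    using assms(1) by (rule circlesE)
  obtain N where D: "D = moebius N ` extended_reals" "N \<in> SL2 R"
    using assms(2) by (rule circlesE)
  note det = det_SL2[OF C(2)] det_SL2[OF D(2)]
  have inj: "inj (moebius N)" using det by (intro bij_is_inj bij_moebius)
  have "C = moebius N ` moebius (adj N ** M) ` extended_reals"
    unfolding moebius_mult_image[OF det(1)] adj_image(2)[OF det(2)] C(1) ..
  then have "C \<inter> moebius N ` A = moebius N ` (moebius (adj N ** M) ` extended_reals \<inter> A)" for A
    by (simp add: image_Int[OF inj])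
  then have "C \<inter> moebius N ` upper = {} \<or> C \<inter> moebius N ` lower = {}"
    using real_image_one_sided[OF SL2_mult[OF SL2_adj[OF D(2)] C(2)]] by auto
  then show ?thesis
    using UV unfolding D(1) complementary_regions_moebius[OF det(2)] by (metis doubleton_eq_iff)
qed

text \<open>After moving \<open>D\<close> to the real line, this is
  \<open>moebius_extended_reals_eqI\<close>.\<close>

lemma circle_subset_imp_eq:
  assumes "C \<in> circles" "D \<in> circles" "C \<subseteq> D"
  shows "C = D"
proof -
  obtain M where C: "C = moebius M ` extended_reals" "M \<in> SL2 R"
    using assms(1) by (rule circlesE)
  obtain N where D: "D = moebius N ` extended_reals" "N \<in> SL2 R"
    using assms(2) by (rule circlesE)
  note det = det_SL2[OF C(2)] det_SL2[OF D(2)]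
  have eq: "moebius (adj N ** M) ` extended_reals = moebius (adj N) ` C"
    unfolding moebius_mult_image[OF det(1)] C(1) ..
  have "moebius (adj N) ` C \<subseteq> moebius (adj N) ` D"
    using assms(3) by (rule image_mono)
  also have "moebius (adj N) ` D = extended_reals"
    unfolding D(1) by (rule adj_image(1)[OF det(2)])
  finally have "moebius (adj N) ` C = extended_reals"
    unfolding eq[symmetric]
    by (intro moebius_extended_reals_eqI det_SL2[OF SL2_mult[OF SL2_adj[OF D(2)] C(2)]])
  then have "moebius N ` moebius (adj N) ` C = D" unfolding D(1) by simp
  then show ?thesis unfolding adj_image(2)[OF det(2)] .
qed

section \<open>A tangent circle on a prescribed side\<close>

lemma translation_SL2: "translation b \<in> SL2 R" if "b \<in> R"
  using that of_int_mem[of 0] of_int_mem[of 1] by (simp add: SL2_iff)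

text \<open>A circle straddling the two lines crosses neither, so the lines lie on different closed
  sides of it and their common point infinity is on the circle. It is then a horizontal line
  strictly between them, at a height in the multiples of \<open>Im w\<close>, which is
  impossible.\<close>

lemma strip_not_straddled:
  assumes N: "N \<in> SL2 R" and s: "s \<in> R" "\<bar>Im s\<bar> = Im w"
  shows "\<not> straddles {extended_reals, moebius (translation s) ` extended_reals}
    (moebius N ` extended_reals)"
proof
  define P where "P = extended_reals \<union> moebius (translation s) ` extended_reals"
  have Un: "\<Union>{extended_reals, moebius (translation s) ` extended_reals} = P"
    by (simp add: P_def)
  assume str: "straddles {extended_reals, moebius (translation s) ` extended_reals} (moebius N ` extended_reals)"
  have det: "det N = 1" using N by (rule det_SL2)
  let ?U = "moebius N ` upper" and ?L = "moebius N ` lower"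
  have hit: "P \<inter> ?U \<noteq> {}" "P \<inter> ?L \<noteq> {}"
    using str unfolding straddles_def complementary_regions_moebius[OF det] Un by simp_all
  have "extended_reals = moebius (translation 0) ` extended_reals"
    by (simp add: moebius_translation_0)
  moreover have "translation 0 \<in> SL2 R"
    using translation_SL2[of 0] of_int_mem[of 0] by simp
  ultimately have ER: "extended_reals \<in> circles" using circlesI by metis
  have circ: "extended_reals \<in> circles" "moebius (translation s) ` extended_reals \<in> circles"
    "moebius N ` extended_reals \<in> circles"
    using ER translation_SL2[OF s(1)] N by (simp_all add: circlesI)
  have None: "None \<in> extended_reals" "None \<in> moebius (translation s) ` extended_reals"
    by (rule None_mem_extended_reals translation_images(3))+
  have "extended_reals \<inter> ?U = {} \<or> extended_reals \<inter> ?L = {}"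
    "moebius (translation s) ` extended_reals \<inter> ?U = {} \<or> moebius (translation s) ` extended_reals \<inter> ?L = {}"
    using circles_do_not_cross[OF _ circ(3) complementary_regions_moebius[OF det]] circ(1,2)
    by simp_all
  \<comment> \<open>Each of \<open>X\<close>, \<open>Y\<close> misses a side while their union meets
    both, so they miss different sides and a common point lies on neither.\<close>
  moreover have "n \<notin> U \<and> n \<notin> L"
    if "X \<inter> U = {} \<or> X \<inter> L = {}" "Y \<inter> U = {} \<or> Y \<inter> L = {}"
      "(X \<union> Y) \<inter> U \<noteq> {}" "(X \<union> Y) \<inter> L \<noteq> {}" "n \<in> X" "n \<in> Y"
    for n :: "complex option" and X Y U L
    using that by blast
  ultimately have "None \<notin> ?U \<and> None \<notin> ?L"
    using hit None unfolding P_def by metis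
  then have "None \<in> moebius N ` extended_reals"
    using moebius_halfplanes_Un[OF det] by (metis ComplI UnE)
  then obtain b where b: "b \<in> R" "moebius N ` extended_reals = moebius (translation b) ` extended_reals"
    by (rule circle_through_infinity[OF N])
  have "P \<inter> moebius (translation b) ` upper \<noteq> {}" "P \<inter> moebius (translation b) ` lower \<noteq> {}"
    using str unfolding straddles_def b(2) complementary_regions_moebius[OF det_translation] Un
    by simp_all
  then obtain p q where pq: "p \<in> P" "p \<in> moebius (translation b) ` upper"
    "q \<in> P" "q \<in> moebius (translation b) ` lower"
    by (meson disjoint_iff)
  then obtain y z where yz: "p = Some y" "q = Some z"
    using pq(2,4) translation_images(1,2)[of b] not_None_eq by metis
  have ImP: "Im x = 0 \<or> Im x = Im s" if "Some x \<in> P" for x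
    using that Some_mem_extended_reals unfolding P_def Un_iff translation_images by blast
  have ys: "Im y = 0 \<or> Im y = Im s" "Im y > Im b" and zs: "Im z = 0 \<or> Im z = Im s" "Im z < Im b"
    using ImP pq unfolding yz by (simp_all only: translation_images)
  obtain k where k: "Im b = of_int k * Im w" using Im_mem[OF b(1)] ..
  have pos: "Im w > 0" using Im_w by simp
  \<comment> \<open>The two cases are a second line above and one below the real line.\<close>
  consider "Im w > of_int k * Im w" "0 < of_int k * Im w" | "0 > of_int k * Im w" "- Im w < of_int k * Im w"
    using ys zs s(2) unfolding k by linarith
  then show False
  proof cases
    case 1
    then have "of_int 0 * Im w < of_int k * Im w" "of_int k * Im w < of_int 1 * Im w" by simp_all
    then have "0 < k" "k < 1"
      using pos by (simp_all only: mult_less_cancel_right_pos of_int_less_iff)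
    then show False by simp
  next
    case 2
    then have "of_int (- 1) * Im w < of_int k * Im w" "of_int k * Im w < of_int 0 * Im w" by simp_all
    then have "- 1 < k" "k < 0"
      using pos by (simp_all only: mult_less_cancel_right_pos of_int_less_iff)
    then show False by simp
  qed
qed

text \<open>With \<open>C\<close> moved to the real line, the neighbour is the nearest horizontal
  line of the arrangement on the side opposite to \<open>I\<close>. It provides a two-element
  candidate that really leaves \<open>C\<close>.\<close>

lemma tangent_neighbour:
  assumes C: "C \<in> circles" and I: "I \<in> complementary_regions C"
  obtains D where "D \<in> circles" "tangent C D" "D \<inter> I = {}" "\<not> D \<subseteq> C"
    "\<And>F. F \<in> circles \<Longrightarrow> \<not> straddles {C, D} F"
proof -
  obtain M where M: "C = moebius M ` extended_reals" "M \<in> SL2 R" using C by (rule circlesE)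
  note det = det_SL2[OF M(2)]
  have inj: "inj (moebius M)" using det by (intro bij_is_inj bij_moebius)
  have wR: "- w \<in> R" "w \<in> R" using w_mem minus_mem by auto
  \<comment> \<open>The line goes below, through \<open>- w\<close>, if \<open>I\<close> comes from
    \<open>upper\<close>, and above, through \<open>w\<close>, if it comes from
    \<open>lower\<close>.\<close>
  obtain s A where s: "s \<in> R" "\<bar>Im s\<bar> = Im w" and A: "I = moebius M ` A"
    "moebius (translation s) ` extended_reals \<inter> A = {}"
  proof -
    have "I = moebius M ` upper \<or> I = moebius M ` lower"
      using I unfolding M(1) complementary_regions_moebius[OF det] by simp
    moreover have "moebius (translation (- w)) ` extended_reals \<inter> upper = {}"
      "moebius (translation w) ` extended_reals \<inter> lower = {}"
      using Im_w by (simp_all add: translation_real_line_disjoint)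
    moreover have "\<bar>Im (- w)\<bar> = Im w" "\<bar>Im w\<bar> = Im w" using Im_w by auto
    ultimately show ?thesis using that[of "- w" upper] that[of w lower] wR by metis
  qed
  let ?T = "moebius (translation s) ` extended_reals"
  define D where "D = moebius (M ** translation s) ` extended_reals"
  have D: "D = moebius M ` ?T"
    unfolding D_def by (rule moebius_mult_image) simp
  have Im_s: "Im s \<noteq> 0" using s(2) Im_w by auto
  show ?thesis
  proof
    show "D \<in> circles"
      using SL2_mult[OF M(2) translation_SL2[OF s(1)]] unfolding D_def by (rule circlesI)
    have "extended_reals \<inter> ?T = {None}"
    proof (rule set_eqI)
      fix p show "p \<in> extended_reals \<inter> ?T \<longleftrightarrow> p \<in> {None}"
        using Im_s translation_images(3)[of s]
        by (cases p) (simp_all add: translation_images Some_mem_extended_reals None_mem_extended_reals)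
    qed
    then have "C \<inter> D = {moebius M None}"
      unfolding D M(1) image_Int[OF inj, symmetric] by simp
    then show "tangent C D" by (simp add: tangent_def)
    show "D \<inter> I = {}" unfolding D A(1) image_Int[OF inj, symmetric] A(2) by simp
    have "Some s \<in> ?T" "Some s \<notin> extended_reals"
      using Im_s by (simp_all add: translation_images Some_mem_extended_reals)
    then show "\<not> D \<subseteq> C" unfolding D M(1) inj_image_subset_iff[OF inj] by (metis subsetD)
    fix F assume "F \<in> circles"
    then obtain N where N: "F = moebius N ` extended_reals" "N \<in> SL2 R" by (rule circlesE)
    \<comment> \<open>Factoring out \<open>M\<close> lets \<open>straddles_moebius\<close> pull the
      claim back to the strip.\<close>
    have "F = moebius (M ** (adj M ** N)) ` extended_reals"
      using det_SL2[OF N(2)] det by (simp add: N(1) moebius_mult_image det_mul adj_image)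
    moreover have "{C, D} = (`) (moebius M) ` {extended_reals, ?T}"
      by (simp add: D M(1))
    moreover have adjMN: "adj M ** N \<in> SL2 R"
      by (rule SL2_mult[OF SL2_adj[OF M(2)] N(2)])
    ultimately show "\<not> straddles {C, D} F"
      using strip_not_straddled[OF adjMN s] straddles_moebius[OF det det_SL2[OF adjMN]] by metis
  qed
qed

end

section \<open>The two packings through a circle\<close>

locale schmidt = quadratic_order "ring_of_integers K" w for K w
begin

lemma schmidt_eq: "schmidt_arrangement K = circles"
  by (simp add: schmidt_arrangement_def circles_def)

text \<open>Here \<open>I\<close> is the side to be avoided, so the packing lies in the other closed
  side. A union leaves no choice of a maximal element to be made.\<close>

definition packing :: "complex option set \<Rightarrow> complex option set \<Rightarrow> complex option set set" where
  "packing C I = \<Union>{P. packing_candidate K P \<and> C \<in> P \<and> \<Union>P \<inter> I = {}}"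

lemma packing_disjoint: "\<Union>(packing C I) \<inter> I = {}"
  by (auto simp: packing_def)

lemma subset_packing:
  "packing_candidate K P \<Longrightarrow> C \<in> P \<Longrightarrow> \<Union>P \<inter> I = {} \<Longrightarrow> P \<subseteq> packing C I"
  unfolding packing_def by (rule Union_upper) simp

lemma candidate_avoids_region:
  assumes "packing_candidate K P" "D \<in> circles" "complementary_regions D = {U, V}"
  shows "\<Union>P \<inter> U = {} \<or> \<Union>P \<inter> V = {}"
  using assms unfolding packing_candidate_def schmidt_eq straddles_def by blast

text \<open>The pair of \<open>C\<close> and its tangent neighbour is a candidate. The second claim
  shows that the packing reaches the side opposite to \<open>I\<close>, on which maximality
  depends.\<close>

lemma packing_neighbour:
  assumes C: "C \<in> circles" and I: "I \<in> complementary_regions C"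
  shows "C \<in> packing C I" "\<exists>D \<in> packing C I. D \<inter> I = {} \<and> \<not> D \<subseteq> C"
proof -
  obtain D where D: "D \<in> circles" "tangent C D" "D \<inter> I = {}" "\<not> D \<subseteq> C"
    "\<And>F. F \<in> circles \<Longrightarrow> \<not> straddles {C, D} F"
    using C I by (rule tangent_neighbour) blast
  have "tangent D C" using D(2) by (simp add: tangent_def Int_commute)
  then have "tangency_connected {C, D}"
    using D(2) unfolding tangency_connected_def by (auto intro: r_into_rtrancl)
  then have "packing_candidate K {C, D}"
    using C D(1,5) unfolding packing_candidate_def schmidt_eq by blast
  moreover have "C \<inter> I = {}"
  proof -
    obtain U V where "complementary_regions C = {U, V}" "U \<union> V = - C"
      using circle_regions[OF C] by metis
    then show ?thesis using I by blast
  qed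
  ultimately have "{C, D} \<subseteq> packing C I"
    using D(3) by (intro subset_packing) auto
  then show "C \<in> packing C I" "\<exists>D \<in> packing C I. D \<inter> I = {} \<and> \<not> D \<subseteq> C"
    using D(3,4) by auto
qed

text \<open>If \<open>D\<close> is straddled by the union, then the circle \<open>C\<close>, common to all the candidates, lies on
  both closed sides of \<open>D\<close>, so that \<open>D = C\<close>.\<close>

lemma packing_candidate_packing:
  assumes C: "C \<in> circles" and I: "I \<in> complementary_regions C"
  shows "packing_candidate K (packing C I)"
  unfolding packing_candidate_def
proof (intro conjI ballI)
  show "packing C I \<subseteq> schmidt_arrangement K"
    by (auto simp: packing_def packing_candidate_def)
  show "tangency_connected (packing C I)"
    unfolding tangency_connected_def
  proof (intro ballI)
    let ?r = "\<lambda>P. {(A, B). A \<in> P \<and> B \<in> P \<and> tangent A B}"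
    fix A B assume "A \<in> packing C I" "B \<in> packing C I"
    then obtain P Q where P: "A \<in> P" "C \<in> P" "packing_candidate K P" "P \<subseteq> packing C I"
      and Q: "B \<in> Q" "C \<in> Q" "packing_candidate K Q" "Q \<subseteq> packing C I"
      unfolding packing_def by blast
    \<comment> \<open>Members of different candidates are linked through the common circle
      \<open>C\<close>.\<close>
    have "(A, C) \<in> (?r P)\<^sup>*" "(C, B) \<in> (?r Q)\<^sup>*"
      using P Q by (auto simp: packing_candidate_def tangency_connected_def)
    moreover have "(?r P)\<^sup>* \<subseteq> (?r (packing C I))\<^sup>*" "(?r Q)\<^sup>* \<subseteq> (?r (packing C I))\<^sup>*"
      using P(4) Q(4) by (auto intro!: rtrancl_mono)
    ultimately show "(A, B) \<in> (?r (packing C I))\<^sup>*"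
      by (meson rtrancl_trans subsetD)
  qed
  fix D assume "D \<in> schmidt_arrangement K"
  then have D: "D \<in> circles" by (simp add: schmidt_eq)
  obtain U V where UV: "complementary_regions D = {U, V}" "U \<union> V = - D"
    using circle_regions[OF D] by metis
  show "\<not> straddles (packing C I) D"
  proof
    assume "straddles (packing C I) D"
    then have "\<Union>(packing C I) \<inter> U \<noteq> {}" "\<Union>(packing C I) \<inter> V \<noteq> {}"
      by (auto simp: straddles_def UV(1))
    then obtain P Q where P: "packing_candidate K P" "C \<in> P" "\<Union>P \<inter> I = {}" "\<Union>P \<inter> U \<noteq> {}"
      and Q: "packing_candidate K Q" "C \<in> Q" "\<Union>Q \<inter> I = {}" "\<Union>Q \<inter> V \<noteq> {}"
      unfolding packing_def by blast
    have "\<Union>P \<inter> V = {}" "\<Union>Q \<inter> U = {}"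
      using candidate_avoids_region[OF P(1) D UV(1)] candidate_avoids_region[OF Q(1) D UV(1)] P(4) Q(4)
      by blast+
    then have "C \<subseteq> D" using P(2) Q(2) UV(2) by blast
    then have "C = D" using circle_subset_imp_eq C D by blast
    \<comment> \<open>One of the candidates meets \<open>U\<close> and the other \<open>V\<close>,
      yet both avoid \<open>I\<close>.\<close>
    then have "I = U \<or> I = V" using I UV(1) by blast
    then show False using P(3,4) Q(3,4) by blast
  qed
qed

text \<open>A candidate through \<open>C\<close> is not straddling \<open>C\<close>, so it avoids
  \<open>I\<close> or \<open>E\<close> and lies in one of the two packings. Each packing meets the
  side it need not avoid, so an enlargement cannot enter the other side and is contained in the
  packing again.\<close>

lemma apollonian_packings_through:
  assumes C: "C \<in> circles" and IE: "complementary_regions C = {I, E}" "I \<union> E = - C"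
  shows "packing C I \<noteq> packing C E"
    "{R. apollonian_packing K R \<and> C \<in> R} = {packing C I, packing C E}"
proof -
  have IE': "complementary_regions C = {E, I}" "E \<union> I = - C"
    unfolding IE(1) IE(2)[symmetric] by (rule insert_commute, rule Un_commute)
  have region: "I \<in> complementary_regions C" "E \<in> complementary_regions C"
    unfolding IE(1) by simp_all
  note mem = region[THEN packing_neighbour(1)[OF C]]
  have hits: "\<Union>(packing C I) \<inter> E \<noteq> {}"
    if I: "I \<in> complementary_regions C" and E: "I \<union> E = - C" for I E
  proof -
    obtain D where "D \<in> packing C I" "D \<inter> I = {}" "\<not> D \<subseteq> C"
      using packing_neighbour(2)[OF C I] by blast
    then show ?thesis using E by blast
  qed
  show "packing C I \<noteq> packing C E"
  proof
    assume "packing C I = packing C E"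
    then show False
      using hits[OF region(1) IE(2)] packing_disjoint[of C E] by simp
  qed
  have sub: "R \<subseteq> packing C I \<or> R \<subseteq> packing C E" if "packing_candidate K R" "C \<in> R" for R
    using candidate_avoids_region[OF that(1) C IE(1)] subset_packing[OF that] by metis
  have max: "apollonian_packing K (packing C I)"
    if I: "I \<in> complementary_regions C" and IE: "complementary_regions C = {I, E}" "I \<union> E = - C" for I E
    unfolding apollonian_packing_def
  proof (intro conjI allI impI)
    show "packing_candidate K (packing C I)"
      using C I by (rule packing_candidate_packing)
    fix Q assume Q: "packing_candidate K Q \<and> packing C I \<subseteq> Q"
    then have "\<Union>(packing C I) \<subseteq> \<Union>Q" by blast
    then have "\<Union>Q \<inter> E \<noteq> {}" using hits[OF I IE(2)] by blast
    then have "\<Union>Q \<inter> I = {}"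
      using candidate_avoids_region[OF conjunct1[OF Q] C IE(1)] by simp
    moreover have "C \<in> Q" using Q packing_neighbour(1)[OF C I] by blast
    ultimately have "Q \<subseteq> packing C I"
      using Q by (intro subset_packing) simp_all
    then show "Q = packing C I" using Q by simp
  qed
  note apollonian = max[OF region(1) IE] max[OF region(2) IE']
  \<comment> \<open>\<open>R\<close> lies in one of the two candidates, and its own maximality turns
    the inclusion into equality.\<close>
  have "R = packing C I \<or> R = packing C E" if R: "apollonian_packing K R" "C \<in> R" for R
  proof -
    have "packing_candidate K R" "\<And>Q. packing_candidate K Q \<Longrightarrow> R \<subseteq> Q \<Longrightarrow> Q = R"
      using R(1) unfolding apollonian_packing_def by blast+
    moreover have "packing_candidate K (packing C I)" "packing_candidate K (packing C E)"
      using C region by (simp_all add: packing_candidate_packing)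
    ultimately show ?thesis using sub[of R] R(2) by metis
  qed
  then show "{R. apollonian_packing K R \<and> C \<in> R} = {packing C I, packing C E}"
    using apollonian mem by (intro set_eqI) (simp, metis)
qed

end

text \<open>The sides come from \<open>circle_regions\<close> and the packings are
  \<open>packing C I\<close> and \<open>packing C E\<close>. The union statement follows, as each
  circle lies in a packing and packings consist of circles of the arrangement.\<close>

theorem theorem1p3:
  fixes K :: "complex set"
  assumes "imaginary_quadratic_field K"
    and "K \<noteq> quadratic_field (-3)"
  shows "(\<forall>C \<in> schmidt_arrangement K.
            \<exists>I E P Q. I \<noteq> E \<and> complementary_regions C = {I, E} \<and>
              P \<noteq> Q \<and> {R. apollonian_packing K R \<and> C \<in> R} = {P, Q} \<and>
              \<Union>P \<inter> I = {} \<and> \<Union>Q \<inter> E = {})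
         \<and> schmidt_arrangement K = \<Union>{P. apollonian_packing K P}"
proof -
  obtain D where "D < 0" and K: "K = quadratic_field D"
    using assms(1) by (auto simp: imaginary_quadratic_field_def)
  interpret imaginary_quadratic D by unfold_locales fact
  obtain w where "quadratic_order (ring_of_integers K) w"
    using quadratic_order_integers assms(2) unfolding K by blast
  then interpret schmidt K w by (simp add: schmidt_def)
  have two: "\<exists>I E P Q. I \<noteq> E \<and> complementary_regions C = {I, E} \<and>
      P \<noteq> Q \<and> {R. apollonian_packing K R \<and> C \<in> R} = {P, Q} \<and> \<Union>P \<inter> I = {} \<and> \<Union>Q \<inter> E = {}"
    if C: "C \<in> schmidt_arrangement K" for C
  proof -
    have C: "C \<in> circles" using C by (simp add: schmidt_eq)
    obtain I E where IE: "complementary_regions C = {I, E}" "I \<inter> E = {}" "I \<noteq> {}" "I \<union> E = - C"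
      using C by (rule circle_regions)
    have "I \<noteq> E" using IE(2,3) by blast
    then show ?thesis
      by (intro exI[of _ I] exI[of _ E] exI[of _ "packing C I"] exI[of _ "packing C E"] conjI
          IE(1) apollonian_packings_through[OF C IE(1,4)] packing_disjoint)
  qed
  moreover have "schmidt_arrangement K = \<Union>{P. apollonian_packing K P}"
  proof
    show "schmidt_arrangement K \<subseteq> \<Union>{P. apollonian_packing K P}"
    proof
      fix C assume "C \<in> schmidt_arrangement K"
      then obtain P Q where "{R. apollonian_packing K R \<and> C \<in> R} = {P, Q}"
        using two by meson
      then have "P \<in> {R. apollonian_packing K R \<and> C \<in> R}" by simp
      then show "C \<in> \<Union>{P. apollonian_packing K P}" by blast
    qed
    show "\<Union>{P. apollonian_packing K P} \<subseteq> schmidt_arrangement K"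
      by (rule Union_least) (simp add: apollonian_packing_def packing_candidate_def)
  qed
  ultimately show ?thesis by (intro conjI ballI)
qed

end
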